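(* Let $n\ge 2$ and let $C_n$ be the cycle on $n$ vertices (for $n=2$, the graph with two vertices joined by an edge). Then the chromatic symmetric function $X_{C_n}$ has the noncommutative analog \[ \widetilde X_{C_n}=\sum_{\substack{I\vDash n,\ i_1=i_{-1}=1,\\ i_2,\dots,i_{-2}\le 2}} 2^{m_1(I)}\Bigl(1-\frac{1}{2^{r}}\Bigr)R_I\;-\;R_{1^n}, \] that is, $\rho(\widetilde X_{C_n})=X_{C_n}$. Here the sum runs over compositions $I=i_1\cdots i_s$ of $n$ whose first part $i_1$ and last part $i_{-1}=i_s$ are both $1$ and all of whose other parts $i_2,\dots,i_{s-1}$ are at most $2$; $m_1(I)$ is the number of parts of $I$ equal to $1$; and $r$ is the largest integer such that $i_1=\dots=i_r=1$.
   Context: A composition $I=i_1\cdots i_s\vDash n$ is a sequence of positive integers with sum $n$; $\ell(I)=s$, $|I|=n$, $1^n$ is the composition with $n$ parts equal to $1$. For compositions $I,J$ of $n$, write $J\preceq I$ if $I$ is a refinement of $J$ (i.e. $J$ is obtained from $I$ by adding together consecutive parts). Let $\varepsilon^I=(-1)^{|I|-\ell(I)}$. The chromatic symmetric function of a graph $G$ is $X_G=\sum_\kappa\prod_{v\in V(G)}x_{\kappa(v)}$, summed over proper colorings $\kappa:V(G)\to\{1,2,\dots\}$. $\mathrm{NSym}$ is the free associative algebra over $\mathbb Q$ generated by $\Lambda_1,\Lambda_2,\dots$ (with $\Lambda_0=1$). Let $\lambda(t)=\sum_{n\ge0}\Lambda_nt^n$ and define $S_n$ by $\sum_{n\ge0}S_nt^n=1/\lambda(-t)$.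 For a composition $I$, $\Lambda^I=\Lambda_{i_1}\Lambda_{i_2}\cdots$ and $S^I=S_{i_1}S_{i_2}\cdots$. The ribbon Schur functions $R_I$ are defined by $\varepsilon^IR_I=\sum_{J\preceq I}\varepsilon^JS^J$. The commutative image $\rho:\mathrm{NSym}\to\mathrm{Sym}$ is the algebra homomorphism with $\rho(\Lambda_k)=e_k$ (the elementary symmetric function); an element $F$ with $\rho(F)=f$ is called a noncommutative analog of $f$. *)

theory Defs
  imports
    Complex_Main
    "HOL-Library.FuncSet"
    "HOL-Library.Poly_Mapping"
    "HOL-Computational_Algebra.Formal_Power_Series"
begin

section \<open>Compositions\<close>

definition compositions :: "nat \<Rightarrow> nat list set" where
  "compositions n = {I. (\<forall>i\<in>set I. 0 < i) \<and> sum_list I = n}"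

text \<open>\<open>coarsening J I\<close> is $J \preceq I$: the list \<open>I\<close> is cut into nonempty consecutive
  blocks and each block is replaced by its sum.\<close>

definition coarsening :: "nat list \<Rightarrow> nat list \<Rightarrow> bool" where
  "coarsening J I \<longleftrightarrow> (\<exists>B. concat B = I \<and> [] \<notin> set B \<and> J = map sum_list B)"

text \<open>On compositions the truncated subtraction is exact, since $\ell(I) \le |I|$.\<close>

definition comp_sign :: "nat list \<Rightarrow> 'a::ring_1" where
  "comp_sign I = (-1) ^ (sum_list I - length I)"

definition leading_ones :: "nat list \<Rightarrow> nat" where
  "leading_ones I = (GREATEST r. r \<le> length I \<and> (\<forall>j<r. I ! j = 1))"

lemma finite_compositions: "finite (compositions n)"
proof -
  have "length I \<le> sum_list I" if "\<forall>i\<in>set I. 0 < i" for I :: "nat list"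
    using that by (induction I) auto
  moreover have "set I \<subseteq> {..sum_list I}" for I :: "nat list"
    using member_le_sum_list by auto
  ultimately have "compositions n \<subseteq> {I. set I \<subseteq> {..n} \<and> length I \<le> n}"
    unfolding compositions_def by blast
  then show ?thesis
    using finite_lists_length_le[of "{..n}" n] finite_subset by auto
qed

lemma finite_coarsenings: "finite {J. coarsening J I}"
proof -
  have len: "length B \<le> length (concat B)" if "[] \<notin> set B" for B :: "nat list list"
    using that
  proof (induction B)
    case (Cons b B)
    then show ?case by (cases b) auto
  qed simp
  have sub: "set (map sum_list B) \<subseteq> {..sum_list (concat B)}" for B :: "nat list list"
    by (induction B) (auto intro: trans_le_add2)
  have "{J. coarsening J I} \<subseteq> {J. set J \<subseteq> {..sum_list I} \<and> length J \<le> length I}"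
    unfolding coarsening_def using len sub by (auto simp: subset_iff)
  then show ?thesis
    using finite_lists_length_le[of "{..sum_list I}" "length I"] finite_subset by auto
qed

section \<open>The free associative algebra NSym\<close>

text \<open>Words form the free monoid, written additively so that the convolution ring structure of
  \<^typ>\<open>'a \<Rightarrow>\<^sub>0 'b\<close> on finitely supported functions is the free associative algebra.\<close>

datatype 'a fword = Word (letters: "'a list")

instantiation fword :: (type) monoid_add
begin

definition zero_fword :: "'a fword" where
  "zero_fword = Word []"

definition plus_fword :: "'a fword \<Rightarrow> 'a fword \<Rightarrow> 'a fword" where
  "plus_fword u v = Word (letters u @ letters v)"

instance
  by standard (simp_all add: zero_fword_def plus_fword_def)

end

text \<open>The letter \<open>k\<close> stands for the generator $\Lambda_{k+1}$.\<close>

type_synonym nsym = "nat fword \<Rightarrow>\<^sub>0 rat"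

definition Lam :: "nat \<Rightarrow> nsym" where
  "Lam k = (if k = 0 then 1 else Poly_Mapping.single (Word [k - 1]) 1)"

definition nsym_scale :: "rat \<Rightarrow> nsym \<Rightarrow> nsym" where
  "nsym_scale c F = Poly_Mapping.map ((*) c) F"

text \<open>The series $\lambda(-t)$ has constant term $1$, so it has a unique two-sided inverse.\<close>

definition lam_neg :: "nsym fps" where
  "lam_neg = Abs_fps (\<lambda>k. (-1) ^ k * Lam k)"

definition Sn :: "nat \<Rightarrow> nsym" where
  "Sn n = fps_nth (fps_right_inverse lam_neg 1) n"

lemma lam_neg_inverse:
  "lam_neg * Abs_fps Sn = 1" "Abs_fps Sn * lam_neg = 1"
proof -
  have 0: "fps_nth lam_neg 0 = 1"
    by (simp add: lam_neg_def Lam_def)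
  have S: "Abs_fps Sn = fps_right_inverse lam_neg 1"
    by (simp add: fps_eq_iff Sn_def)
  show "lam_neg * Abs_fps Sn = 1"
    unfolding S by (rule fps_right_inverse) (simp add: 0)
  show "Abs_fps Sn * lam_neg = 1"
    unfolding S by (rule fps_left_inverse'[where x = 1]) (simp_all add: 0)
qed

definition S_comp :: "nat list \<Rightarrow> nsym" where
  "S_comp I = prod_list (map Sn I)"

definition ribbon :: "nat list \<Rightarrow> nsym" where
  "ribbon I = comp_sign I * (\<Sum>J | coarsening J I. comp_sign J * S_comp J)"

lemma ribbon_eq:
  "comp_sign I * ribbon I = (\<Sum>J | coarsening J I. comp_sign J * S_comp J)"
proof -
  have "comp_sign I * comp_sign I = (1 :: nsym)"
    by (simp add: comp_sign_def flip: power_mult_distrib power_add mult_2)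
  then show ?thesis
    by (simp add: ribbon_def flip: mult.assoc)
qed

section \<open>Formal power series in countably many commuting variables\<close>

text \<open>A monomial is a finitely supported exponent vector; a series is an arbitrary family of
  rational coefficients. Symmetric functions live in this ring.\<close>

type_synonym monom = "nat \<Rightarrow>\<^sub>0 nat"

lemma finite_monom_decomp: "finite {(a, b). a + b = (m :: monom)}"
proof -
  let ?D = "{a :: monom. \<exists>b. a + b = m}"
  let ?F = "{f. \<forall>x. (x \<in> Poly_Mapping.keys m \<longrightarrow>
      f x \<in> {..Max (Poly_Mapping.lookup m ` Poly_Mapping.keys m)}) \<and>
    (x \<notin> Poly_Mapping.keys m \<longrightarrow> f x = (0::nat))}"
  have "Poly_Mapping.lookup ` ?D \<subseteq> ?F"
  proof safe
    fix a b :: monom and x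
    have le: "Poly_Mapping.lookup a x \<le> Poly_Mapping.lookup (a + b) x"
      by (simp add: lookup_add)
    show "Poly_Mapping.lookup a x \<le> Max (Poly_Mapping.lookup (a + b) ` Poly_Mapping.keys (a + b))"
      if "x \<in> Poly_Mapping.keys (a + b)"
      using le that by (auto intro: le_trans Max_ge)
    show "Poly_Mapping.lookup a x = 0" if "x \<notin> Poly_Mapping.keys (a + b)"
      using le that by (simp add: in_keys_iff)
  qed
  moreover have "finite ?F"
    by (rule finite_set_of_finite_funs) simp_all
  ultimately have "finite (Poly_Mapping.lookup ` ?D)"
    by (rule finite_subset)
  moreover have "inj_on Poly_Mapping.lookup ?D"
    by (auto intro: inj_onI poly_mapping_eqI)
  ultimately have D: "finite ?D"
    by (rule finite_imageD)
  have "{(a, b). a + b = m} \<subseteq> ?D \<times> ?D"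
    by safe (auto, metis add.commute)
  then show ?thesis
    using D finite_subset by blast
qed

typedef mseries = "UNIV :: (monom \<Rightarrow> rat) set"
  morphisms mcoeff Abs_mseries ..

setup_lifting type_definition_mseries

lemma mseries_eqI: "(\<And>m. mcoeff f m = mcoeff g m) \<Longrightarrow> f = g"
  using mcoeff_inject[of f g] by auto

instantiation mseries :: comm_ring_1
begin

lift_definition zero_mseries :: mseries is "\<lambda>_. 0" .
lift_definition one_mseries :: mseries is "\<lambda>m. if m = 0 then 1 else 0" .
lift_definition plus_mseries :: "mseries \<Rightarrow> mseries \<Rightarrow> mseries" is "\<lambda>f g m. f m + g m" .
lift_definition minus_mseries :: "mseries \<Rightarrow> mseries \<Rightarrow> mseries" is "\<lambda>f g m. f m - g m" .
lift_definition uminus_mseries :: "mseries \<Rightarrow> mseries" is "\<lambda>f m. - f m" .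
lift_definition times_mseries :: "mseries \<Rightarrow> mseries \<Rightarrow> mseries"
  is "\<lambda>f g m. \<Sum>(a, b) | a + b = m. f a * g b" .

instance
proof
  fix f g h :: mseries
  show "f * g * h = f * (g * h)"
  proof (transfer, rule ext)
    fix f g h :: "monom \<Rightarrow> rat" and m :: monom
    let ?D = "\<lambda>m :: monom. {(a, b). a + b = m}"
    have "(\<Sum>(p, c)\<in>?D m. (\<Sum>(a, b)\<in>?D p. f a * g b) * h c)
        = (\<Sum>x\<in>?D m. \<Sum>y\<in>?D (fst x). f (fst y) * g (snd y) * h (snd x))"
      by (simp add: sum_distrib_right case_prod_beta)
    also have "\<dots> = (\<Sum>(x, y)\<in>Sigma (?D m) (\<lambda>x. ?D (fst x)). f (fst y) * g (snd y) * h (snd x))"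
      by (rule sum.Sigma) (use finite_monom_decomp in blast)+
    also have "\<dots> = (\<Sum>(x, y)\<in>Sigma (?D m) (\<lambda>x. ?D (snd x)). f (fst x) * (g (fst y) * h (snd y)))"
      by (rule sum.reindex_bij_witness
            [where i = "\<lambda>((a, q), (b, c)). ((a + b, c), (a, b))"
               and j = "\<lambda>((p, c), (a, b)). ((a, b + c), (b, c))"])
         (auto simp: add.assoc mult.assoc)
    also have "\<dots> = (\<Sum>x\<in>?D m. \<Sum>y\<in>?D (snd x). f (fst x) * (g (fst y) * h (snd y)))"
      by (rule sum.Sigma[symmetric]) (use finite_monom_decomp in blast)+
    also have "\<dots> = (\<Sum>(a, q)\<in>?D m. f a * (\<Sum>(b, c)\<in>?D q. g b * h c))"
      by (simp add: sum_distrib_left case_prod_beta)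
    finally show "(\<Sum>(p, c)\<in>?D m. (\<Sum>(a, b)\<in>?D p. f a * g b) * h c)
        = (\<Sum>(a, q)\<in>?D m. f a * (\<Sum>(b, c)\<in>?D q. g b * h c))" .
  qed
  show "f * g = g * f"
  proof (transfer, rule ext)
    fix f g :: "monom \<Rightarrow> rat" and m :: monom
    show "(\<Sum>(a, b) | a + b = m. f a * g b) = (\<Sum>(a, b) | a + b = m. g a * f b)"
      by (rule sum.reindex_bij_witness[where i = prod.swap and j = prod.swap])
         (auto simp: add.commute mult.commute)
  qed
  show "1 * f = f"
  proof (transfer, rule ext)
    fix f :: "monom \<Rightarrow> rat" and m :: monom
    have "(\<Sum>(a, b) | a + b = m. (if a = 0 then 1 else 0) * f b)
        = (\<Sum>(a, b)\<in>{(0 :: monom, m)}. (if a = 0 then 1 else 0) * f b)"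
      by (rule sum.mono_neutral_right) (use finite_monom_decomp in \<open>auto split: if_splits\<close>)
    then show "(\<Sum>(a, b) | a + b = m. (if a = 0 then 1 else 0) * f b) = f m"
      by simp
  qed
  show "(f + g) * h = f * h + g * h"
    by transfer (simp add: case_prod_beta distrib_right sum.distrib)
  show "(0 :: mseries) \<noteq> 1"
    by transfer (metis zero_neq_one)
qed (transfer; simp add: algebra_simps)+

end

lift_definition mconst :: "rat \<Rightarrow> mseries" is "\<lambda>c m. if m = 0 then c else 0" .

text \<open>The variables are $x_1, x_2, \dots$; the index $0$ is never used.\<close>

definition var_prod :: "'v set \<Rightarrow> ('v \<Rightarrow> nat) \<Rightarrow> monom" where
  "var_prod V \<kappa> = (\<Sum>v\<in>V. Poly_Mapping.single (\<kappa> v) 1)"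

text \<open>$e_k$ is the sum of all $\prod_{i \in A} x_i$ with $|A| = k$; distinct sets give distinct
  monomials.\<close>

lift_definition elem_sym :: "nat \<Rightarrow> mseries" is
  "\<lambda>k m. if \<exists>A. finite A \<and> A \<subseteq> {1..} \<and> card A = k \<and> m = var_prod A id then 1 else 0" .

section \<open>The commutative image\<close>

definition comm_image :: "nsym \<Rightarrow> mseries" where
  "comm_image F =
    (\<Sum>w\<in>Poly_Mapping.keys F.
      mconst (Poly_Mapping.lookup F w) * prod_list (map (\<lambda>k. elem_sym (Suc k)) (letters w)))"

lemma mconst_0: "mconst 0 = 0" and mconst_1: "mconst 1 = 1"
  and mconst_add: "mconst (a + b) = mconst a + mconst b"
  by (transfer; auto)+

lemma mcoeff_mconst_mult: "mcoeff (mconst c * f) m = c * mcoeff f m"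
proof transfer
  fix c :: rat and f :: "monom \<Rightarrow> rat" and m :: monom
  have "(\<Sum>(a, b) | a + b = m. (if a = 0 then c else 0) * f b)
      = (\<Sum>(a, b)\<in>{(0 :: monom, m)}. (if a = 0 then c else 0) * f b)"
    by (rule sum.mono_neutral_right) (use finite_monom_decomp in \<open>auto split: if_splits\<close>)
  then show "(\<Sum>(a, b) | a + b = m. (if a = 0 then c else 0) * f b) = c * f m"
    by simp
qed

lemma mconst_mult: "mconst (a * b) = mconst a * mconst b"
  by (rule mseries_eqI, simp add: mcoeff_mconst_mult, transfer, simp)

lemma comm_image_superset:
  assumes "finite A" "Poly_Mapping.keys F \<subseteq> A"
  shows "comm_image F =
    (\<Sum>w\<in>A.
      mconst (Poly_Mapping.lookup F w) * prod_list (map (\<lambda>k. elem_sym (Suc k)) (letters w)))"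
  unfolding comm_image_def
  by (rule sum.mono_neutral_left) (use assms in \<open>auto simp: in_keys_iff mconst_0\<close>)

lemma comm_image_add: "comm_image (F + G) = comm_image F + comm_image G"
proof -
  have "Poly_Mapping.keys (F + G) \<subseteq> Poly_Mapping.keys F \<union> Poly_Mapping.keys G"
    by (rule Poly_Mapping.keys_add)
  then show ?thesis
    using comm_image_superset[of "Poly_Mapping.keys F \<union> Poly_Mapping.keys G"]
    by (simp add: lookup_add mconst_add distrib_right sum.distrib)
qed

lemma comm_image_single:
  "comm_image (Poly_Mapping.single w c) =
    mconst c * prod_list (map (\<lambda>k. elem_sym (Suc k)) (letters w))"
  by (subst comm_image_superset[of "{w}"]) auto

lemma comm_image_0: "comm_image 0 = 0"
  by (simp add: comm_image_def)

lemma nsym_induct [case_names single add]: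
  assumes "\<And>w c. P (Poly_Mapping.single w c)" "\<And>F G. P F \<Longrightarrow> P G \<Longrightarrow> P (F + G)"
  shows "P (F :: nsym)"
proof (induction F rule: update_induct)
  case const
  then show ?case using assms(1)[of 0 0] by simp
next
  case (update f a b)
  have "Poly_Mapping.update a b f = f + Poly_Mapping.single a b"
    using update(1)
    by (intro poly_mapping_eqI) (auto simp: lookup_add lookup_single update.rep_eq in_keys_iff)
  then show ?case using assms update by simp
qed

lemma comm_image_mult: "comm_image (F * G) = comm_image F * comm_image G"
proof (induction F rule: nsym_induct)
  case (single w c)
  show ?case
  proof (induction G rule: nsym_induct)
    case (single v d)
    show ?case
      by (simp add: mult_single comm_image_single plus_fword_def mconst_mult mult_ac)
  qed (simp add: distrib_left comm_image_add)
qed (simp add: distrib_right comm_image_add)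

lemma comm_image_1: "comm_image 1 = 1"
  using comm_image_single[of 0 1] by (simp, simp add: zero_fword_def mconst_1)

lemma comm_image_scale: "comm_image (nsym_scale c F) = mconst c * comm_image F"
  by (simp add: nsym_scale_def mult_map_scale_conv_mult comm_image_mult comm_image_single
      zero_fword_def)

lemma elem_sym_0: "elem_sym 0 = 1"
  by transfer (auto simp: var_prod_def fun_eq_iff)

lemma comm_image_Lam: "comm_image (Lam k) = elem_sym k"
  by (cases k) (simp_all add: Lam_def comm_image_1 elem_sym_0 comm_image_single mconst_1)

definition nc_analog :: "nsym \<Rightarrow> mseries \<Rightarrow> bool" where
  "nc_analog F f \<longleftrightarrow> comm_image F = f"

section \<open>Chromatic symmetric functions\<close>

text \<open>A graph is given by its finite vertex set and its set of edges, each edge being the set of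
  its two endpoints. Colorings are extensional functions, hence determined by their values on the
  vertices. Each monomial arises from only finitely many colorings.\<close>

definition proper_colorings :: "'v set \<Rightarrow> 'v set set \<Rightarrow> ('v \<Rightarrow> nat) set" where
  "proper_colorings V E =
    {\<kappa> \<in> V \<rightarrow>\<^sub>E {1..}. \<forall>u\<in>V. \<forall>v\<in>V. {u, v} \<in> E \<longrightarrow> \<kappa> u \<noteq> \<kappa> v}"

lift_definition chromatic_sym :: "'v set \<Rightarrow> 'v set set \<Rightarrow> mseries" is
  "\<lambda>V E m. of_nat (card {\<kappa> \<in> proper_colorings V E. var_prod V \<kappa> = m})" .

lemma finite_colorings_monom:
  assumes "finite V"
  shows "finite {\<kappa> \<in> proper_colorings V E. var_prod V \<kappa> = m}"
proof (rule finite_subset)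
  have "\<kappa> v \<in> Poly_Mapping.keys (var_prod V \<kappa>)" if "v \<in> V" for \<kappa> :: "'a \<Rightarrow> nat" and v
  proof -
    have "Poly_Mapping.lookup (var_prod V \<kappa>) (\<kappa> v)
        = (\<Sum>u\<in>V. Poly_Mapping.lookup (Poly_Mapping.single (\<kappa> u) 1) (\<kappa> v))"
      by (simp add: var_prod_def lookup_sum)
    also have "\<dots> \<ge> Poly_Mapping.lookup (Poly_Mapping.single (\<kappa> v) 1) (\<kappa> v)"
      by (rule member_le_sum) (use assms that in auto)
    finally show ?thesis
      by (simp add: in_keys_iff)
  qed
  then show "{\<kappa> \<in> proper_colorings V E. var_prod V \<kappa> = m} \<subseteq> V \<rightarrow>\<^sub>E Poly_Mapping.keys m"
    by (auto simp: proper_colorings_def PiE_iff extensional_def)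
  show "finite (V \<rightarrow>\<^sub>E Poly_Mapping.keys m)"
    using assms by (simp add: finite_PiE)
qed

text \<open>For $n = 2$ the two indices give the same edge.\<close>

definition cycle_verts :: "nat \<Rightarrow> nat set" where
  "cycle_verts n = {..<n}"

definition cycle_edges :: "nat \<Rightarrow> nat set set" where
  "cycle_edges n = {{i, Suc i mod n} | i. i < n}"

end

theory Submission
  imports Defs
begin

text \<open>
  Both sides satisfy the recurrence
  $X_n = \sum_{k=2}^{n-2} (k-1)\, e_k X_{n-k} + n(n-1)\, e_n$.

  For the ribbon side write the sum as $\sum_I c(I) R_I$, the term $-R_{1^n}$ being absorbed into
  the coefficients. Then $c(K \cdot 2 \cdot 1) = c(K \cdot 1)$, and $c(K \cdot 1) = 2 c(K)$ unless
  $K$ consists of ones only. Together with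
  $R_{K \cdot 1} \Lambda_k = R_{K \cdot 1 \cdot 1^k} + R_{K \cdot 2 \cdot 1^{k-1}}$ this determines the
  second differences of $V(n, k) = \sum_{I \vDash n} c(I) R_{I \cdot 1^k}$ along the lines
  $n + k = \mathrm{const}$, and summing twice gives the recurrence.

  For the chromatic side put $\lambda = \sum_k e_k t^k$ and
  $Q = \sum_{k \ge 1} (-1)^{k-1} p_k t^k$. Merging the end points of a path
  or an edge at its first vertex yields $P = 1/(1-Q)$ for paths and $C = t Q' P - Q$ for cycles,
  and Newton's identities $t \lambda' = Q \lambda$ turn this into
  $(\lambda - t \lambda') C = t^2 \lambda''$.
\<close>

section \<open>Generating functions of weighted sets\<close>

text \<open>\<open>card\<close> is 0 on infinite sets, so sums and products of generating functions
  count correctly only if each monomial has finitely many preimages.\<close>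

definition finite_fibres :: "'a set \<Rightarrow> ('a \<Rightarrow> monom) \<Rightarrow> bool" where
  "finite_fibres T w \<longleftrightarrow> (\<forall>m. finite {x \<in> T. w x = m})"

definition gen_fun :: "'a set \<Rightarrow> ('a \<Rightarrow> monom) \<Rightarrow> mseries" where
  "gen_fun T w = Abs_mseries (\<lambda>m. of_nat (card {x \<in> T. w x = m}))"

lemma mcoeff_gen_fun: "mcoeff (gen_fun T w) m = of_nat (card {x \<in> T. w x = m})"
  by (simp add: gen_fun_def Abs_mseries_inverse)

lemma finite_fibres_subset: "finite_fibres U w \<Longrightarrow> T \<subseteq> U \<Longrightarrow> finite_fibres T w"
  unfolding finite_fibres_def
proof
  fix m
  assume "\<forall>m. finite {x \<in> U. w x = m}" "T \<subseteq> U"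
  then show "finite {x \<in> T. w x = m}"
    by (intro finite_subset[of "{x \<in> T. w x = m}" "{x \<in> U. w x = m}"]) auto
qed

lemma finite_fibresI:
  assumes "\<And>m. finite (F m)" "\<And>x. x \<in> T \<Longrightarrow> x \<in> F (w x)"
  shows "finite_fibres T w"
  unfolding finite_fibres_def
proof
  fix m
  have "{x \<in> T. w x = m} \<subseteq> F m" using assms(2) by auto
  then show "finite {x \<in> T. w x = m}" using assms(1) finite_subset by blast
qed

lemma finite_fibres_times:
  assumes "finite_fibres T w" "finite_fibres U v"
  shows "finite_fibres (T \<times> U) (\<lambda>(x, y). w x + v y)"
proof (rule finite_fibresI)
  fix m
  show "finite (\<Union>(a, b)\<in>{(a, b). a + b = m}. {x \<in> T. w x = a} \<times> {y \<in> U. v y = b})"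
    using assms finite_monom_decomp[of m] by (auto simp: finite_fibres_def)
qed auto

lemma gen_fun_bij:
  assumes "bij_betw f T U" "\<And>x. x \<in> T \<Longrightarrow> v (f x) = w x"
  shows "gen_fun T w = gen_fun U v"
proof (rule mseries_eqI)
  fix m
  have "bij_betw f {x \<in> T. w x = m} {y \<in> U. v y = m}"
    using assms unfolding bij_betw_def inj_on_def by auto
  then show "mcoeff (gen_fun T w) m = mcoeff (gen_fun U v) m"
    by (simp add: mcoeff_gen_fun bij_betw_same_card)
qed

lemma gen_fun_Un:
  assumes "finite_fibres T w" "finite_fibres U w" "T \<inter> U = {}"
  shows "gen_fun (T \<union> U) w = gen_fun T w + gen_fun U w"
proof (rule mseries_eqI)
  fix m
  have "card {x \<in> T \<union> U. w x = m} = card ({x \<in> T. w x = m} \<union> {x \<in> U. w x = m})"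
    by (rule arg_cong[where f = card]) auto
  also have "\<dots> = card {x \<in> T. w x = m} + card {x \<in> U. w x = m}"
    using assms by (intro card_Un_disjoint) (auto simp: finite_fibres_def)
  finally show "mcoeff (gen_fun (T \<union> U) w) m = mcoeff (gen_fun T w + gen_fun U w) m"
    by (simp add: mcoeff_gen_fun plus_mseries.rep_eq)
qed

lemma gen_fun_split:
  assumes "finite_fibres T w"
  shows "gen_fun T w = gen_fun {x \<in> T. P x} w + gen_fun {x \<in> T. \<not> P x} w"
proof -
  have "gen_fun ({x \<in> T. P x} \<union> {x \<in> T. \<not> P x}) w
      = gen_fun {x \<in> T. P x} w + gen_fun {x \<in> T. \<not> P x} w"
    by (intro gen_fun_Un finite_fibres_subset[OF assms]) auto
  moreover have "{x \<in> T. P x} \<union> {x \<in> T. \<not> P x} = T" by auto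
  ultimately show ?thesis by simp
qed

lemma gen_fun_empty: "T = {} \<Longrightarrow> gen_fun T w = 0"
  by (rule mseries_eqI) (simp add: mcoeff_gen_fun zero_mseries.rep_eq)

text \<open>The fibre of the product over \<open>m\<close> is the disjoint union, over the finitely
  many decompositions \<open>a + b = m\<close>, of the rectangles spanned by the fibres over
  \<open>a\<close> and \<open>b\<close>.\<close>

lemma gen_fun_times:
  assumes "finite_fibres T w" "finite_fibres U v"
  shows "gen_fun T w * gen_fun U v = gen_fun (T \<times> U) (\<lambda>(x, y). w x + v y)"
proof (rule mseries_eqI)
  fix m
  have "{p \<in> T \<times> U. (\<lambda>(x, y). w x + v y) p = m}
      = (\<Union>d\<in>{(a, b). a + b = m}. {x \<in> T. w x = fst d} \<times> {y \<in> U. v y = snd d})"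
    by auto
  moreover have "card (\<Union>d\<in>{(a, b). a + b = m}. {x \<in> T. w x = fst d} \<times> {y \<in> U. v y = snd d})
      = (\<Sum>d\<in>{(a, b). a + b = m}. card ({x \<in> T. w x = fst d} \<times> {y \<in> U. v y = snd d}))"
  proof (rule card_UN_disjoint)
    show "finite {(a, b). a + b = m}" by (rule finite_monom_decomp)
    show "\<forall>d\<in>{(a, b). a + b = m}. finite ({x \<in> T. w x = fst d} \<times> {y \<in> U. v y = snd d})"
      using assms by (simp add: finite_fibres_def)
    show "\<forall>d\<in>{(a, b). a + b = m}. \<forall>e\<in>{(a, b). a + b = m}. d \<noteq> e \<longrightarrow>
        ({x \<in> T. w x = fst d} \<times> {y \<in> U. v y = snd d})
        \<inter> ({x \<in> T. w x = fst e} \<times> {y \<in> U. v y = snd e}) = {}"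
      by (fastforce simp: prod_eq_iff)
  qed
  ultimately have "card {p \<in> T \<times> U. (\<lambda>(x, y). w x + v y) p = m}
      = (\<Sum>d\<in>{(a, b). a + b = m}. card ({x \<in> T. w x = fst d} \<times> {y \<in> U. v y = snd d}))"
    by (simp only:)
  then show "mcoeff (gen_fun T w * gen_fun U v) m
      = mcoeff (gen_fun (T \<times> U) (\<lambda>(x, y). w x + v y)) m"
    by (simp add: mcoeff_gen_fun times_mseries.rep_eq card_cartesian_product case_prod_beta)
qed

lemma mcoeff_of_nat_mult: "mcoeff (of_nat k * f) m = of_nat k * mcoeff f m"
  by (induction k) (simp_all add: zero_mseries.rep_eq plus_mseries.rep_eq distrib_right)

section \<open>Power sums and Newton's identities\<close>

definition power_sum :: "nat \<Rightarrow> mseries" where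
  "power_sum k = gen_fun {1..} (\<lambda>i. Poly_Mapping.single i k)"

definition var_sets :: "nat \<Rightarrow> nat set set" where
  "var_sets k = {A. finite A \<and> A \<subseteq> {1..} \<and> card A = k}"

lemma lookup_var_prod_id:
  "finite A \<Longrightarrow> Poly_Mapping.lookup (var_prod A id) x = (if x \<in> A then 1 else 0)"
  by (simp add: var_prod_def lookup_sum lookup_single when_def)

lemma keys_var_prod_id: "finite A \<Longrightarrow> Poly_Mapping.keys (var_prod A id) = A"
  by (auto simp: in_keys_iff lookup_var_prod_id split: if_splits)

lemma finite_fibres_var_sets: "finite_fibres (var_sets k) (\<lambda>A. var_prod A id)"
  by (rule finite_fibresI[where F = "\<lambda>m. {Poly_Mapping.keys m}"])
     (auto simp: var_sets_def keys_var_prod_id)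

lemma finite_fibres_single: "0 < k \<Longrightarrow> finite_fibres T (\<lambda>i. Poly_Mapping.single i k)"
  by (rule finite_fibresI[where F = Poly_Mapping.keys]) auto

text \<open>A square-free monomial determines its set of variables, so every fibre has at most one
  element and its cardinality is the 0/1 coefficient of \<open>elem_sym\<close>.\<close>

lemma elem_sym_gen_fun: "elem_sym k = gen_fun (var_sets k) (\<lambda>A. var_prod A id)"
proof (rule mseries_eqI)
  fix m
  let ?F = "{A \<in> var_sets k. var_prod A id = m}"
  have "?F \<subseteq> {Poly_Mapping.keys m}"
    by (auto simp: var_sets_def keys_var_prod_id)
  moreover have "of_nat (card F) = (if \<exists>A. A \<in> F then 1 else 0 :: rat)"
    if "F \<subseteq> {B}" for F :: "nat set set" and B
    using subset_singletonD[OF that] by auto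
  ultimately have "of_nat (card ?F) = (if \<exists>A. A \<in> ?F then 1 else 0 :: rat)"
    by blast
  moreover have "(\<exists>A. A \<in> ?F) \<longleftrightarrow>
      (\<exists>A. finite A \<and> A \<subseteq> {1..} \<and> card A = k \<and> m = var_prod A id)"
    by (auto simp: var_sets_def)
  ultimately show "mcoeff (elem_sym k) m = mcoeff (gen_fun (var_sets k) (\<lambda>A. var_prod A id)) m"
    by (simp only: elem_sym.rep_eq mcoeff_gen_fun)
qed

text \<open>For \<open>j \<ge> 2\<close> this is the monomial symmetric function of the hook shape
  (j, 1^l); for \<open>j = 1\<close> every monomial is counted \<open>l + 1\<close> times.\<close>

definition hook_sum :: "nat \<Rightarrow> nat \<Rightarrow> mseries" where
  "hook_sum j l = gen_fun {(i, A). (i, A) \<in> {1..} \<times> var_sets l \<and> i \<notin> A}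
    (\<lambda>(i, A). Poly_Mapping.single i j + var_prod A id)"

lemma var_prod_insert:
  "finite A \<Longrightarrow> i \<notin> A \<Longrightarrow> var_prod (insert i A) id = Poly_Mapping.single i 1 + var_prod A id"
  by (simp add: var_prod_def)

text \<open>Serves twice: to absorb a repeated variable into a higher exponent, and to read
  \<open>hook_sum 1 l\<close> as sets with a marked element.\<close>

lemma bij_betw_insert_var_sets:
  "bij_betw (\<lambda>(i, A). (i, insert i A)) {(i, A). (i, A) \<in> {1..} \<times> var_sets l \<and> i \<notin> A}
    {(i, A). (i, A) \<in> {1..} \<times> var_sets (Suc l) \<and> i \<in> A}"
proof (rule bij_betw_byWitness[where f' = "\<lambda>(i, A). (i, A - {i})"])
  show "(\<lambda>(i, A). (i, A - {i})) ` {(i, A). (i, A) \<in> {1..} \<times> var_sets (Suc l) \<and> i \<in> A}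
      \<subseteq> {(i, A). (i, A) \<in> {1..} \<times> var_sets l \<and> i \<notin> A}"
    by (fastforce simp: var_sets_def)
qed (auto simp: var_sets_def)

text \<open>Split the pairs \<open>(i, A)\<close> by whether \<open>i\<close> lies in
  \<open>A\<close>. If it does, removing it from \<open>A\<close> raises the exponent of x_i from
  \<open>j\<close> to \<open>j + 1\<close>.\<close>

lemma power_sum_mult_elem_sym:
  assumes "0 < j"
  shows "power_sum j * elem_sym (Suc l) = hook_sum j (Suc l) + hook_sum (Suc j) l"
proof -
  let ?w = "\<lambda>j (i, A). Poly_Mapping.single i j + var_prod A id"
  let ?T = "{1..} \<times> var_sets (Suc l)"
  have fin: "finite_fibres ?T (?w j)"
    using finite_fibres_times[OF finite_fibres_single[OF assms] finite_fibres_var_sets] .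
  have "power_sum j * elem_sym (Suc l) = gen_fun ?T (?w j)"
    unfolding power_sum_def elem_sym_gen_fun
    by (intro gen_fun_times finite_fibres_single finite_fibres_var_sets assms)
  also have "\<dots> = gen_fun {p \<in> ?T. fst p \<notin> snd p} (?w j) + gen_fun {p \<in> ?T. \<not> fst p \<notin> snd p} (?w j)"
    by (rule gen_fun_split[OF fin])
  also have "{p \<in> ?T. fst p \<notin> snd p} = {(i, A). (i, A) \<in> ?T \<and> i \<notin> A}" by auto
  also have "{p \<in> ?T. \<not> fst p \<notin> snd p} = {(i, A). (i, A) \<in> ?T \<and> i \<in> A}" by auto
  also have "gen_fun {(i, A). (i, A) \<in> ?T \<and> i \<in> A} (?w j) = hook_sum (Suc j) l"
    unfolding hook_sum_def
  proof (rule gen_fun_bij[OF bij_betw_insert_var_sets, symmetric])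
    fix x :: "nat \<times> nat set"
    assume "x \<in> {(i, A). (i, A) \<in> {1..} \<times> var_sets l \<and> i \<notin> A}"
    then obtain i A where "x = (i, A)" "finite A" "i \<notin> A" by (auto simp: var_sets_def)
    then show "?w j ((\<lambda>(i, A). (i, insert i A)) x) = ?w (Suc j) x"
      by (simp add: var_prod_insert single_add[symmetric] flip: add.assoc)
  qed
  also have "gen_fun {(i, A). (i, A) \<in> ?T \<and> i \<notin> A} (?w j) = hook_sum j (Suc l)"
    by (simp only: hook_sum_def)
  finally show ?thesis .
qed

text \<open>With exponent 1 the marked variable looks like all others, so a set of
  \<open>l + 1\<close> variables arises once from each of its elements.\<close>

lemma hook_sum_one: "hook_sum 1 l = of_nat (Suc l) * elem_sym (Suc l)"
proof -
  let ?T = "{(i, A). (i, A) \<in> {1..} \<times> var_sets (Suc l) \<and> i \<in> A}"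
  have "hook_sum 1 l = gen_fun ?T (\<lambda>(i, A). var_prod A id)"
    unfolding hook_sum_def
    by (rule gen_fun_bij[OF bij_betw_insert_var_sets]) (auto simp: var_prod_insert var_sets_def)
  also have "\<dots> = of_nat (Suc l) * gen_fun (var_sets (Suc l)) (\<lambda>A. var_prod A id)"
  proof (rule mseries_eqI)
    fix m
    let ?F = "{A \<in> var_sets (Suc l). var_prod A id = m}"
    \<comment> \<open>Double counting: with the set put first, each \<open>A\<close> in the fibre
      contributes its \<open>Suc l\<close> elements.\<close>
    have "bij_betw prod.swap {x \<in> ?T. (\<lambda>(i, A). var_prod A id) x = m} (SIGMA A:?F. A)"
      by (rule bij_betw_byWitness[where f' = prod.swap]) (auto simp: var_sets_def)
    then have "card {x \<in> ?T. (\<lambda>(i, A). var_prod A id) x = m} = card (SIGMA A:?F. A)"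
      by (rule bij_betw_same_card)
    also have "\<dots> = (\<Sum>A\<in>?F. card A)"
      using finite_fibres_var_sets[of "Suc l"]
      by (intro card_SigmaI) (auto simp: finite_fibres_def var_sets_def)
    also have "\<dots> = Suc l * card ?F"
      by (simp add: var_sets_def)
    finally show "mcoeff (gen_fun ?T (\<lambda>(i, A). var_prod A id)) m
        = mcoeff (of_nat (Suc l) * gen_fun (var_sets (Suc l)) (\<lambda>A. var_prod A id)) m"
      unfolding mcoeff_of_nat_mult mcoeff_gen_fun by (simp only: of_nat_mult)
  qed
  finally show ?thesis by (simp add: elem_sym_gen_fun)
qed

lemma hook_sum_zero: "hook_sum j 0 = power_sum j"
  unfolding power_sum_def hook_sum_def
proof (rule gen_fun_bij[where f = fst])
  show "bij_betw fst {(i, A). (i, A) \<in> {1..} \<times> var_sets 0 \<and> i \<notin> A} {1..}"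
    by (rule bij_betw_byWitness[where f' = "\<lambda>i. (i, {})"]) (auto simp: var_sets_def)
qed (auto simp: var_sets_def var_prod_def)

text \<open>Solving \<open>power_sum_mult_elem_sym\<close> for its first hook and iterating moves
  one unit at a time from the set into the exponent, with a change of sign, until the set is
  empty.\<close>

lemma hook_sum_alternating:
  "0 < j \<Longrightarrow> hook_sum j l = (\<Sum>i\<le>l. (-1) ^ i * power_sum (j + i) * elem_sym (l - i))"
proof (induction l arbitrary: j)
  case 0
  then show ?case by (simp add: hook_sum_zero elem_sym_0)
next
  case (Suc l)
  have "hook_sum j (Suc l) = power_sum j * elem_sym (Suc l) - hook_sum (Suc j) l"
    using power_sum_mult_elem_sym[OF Suc.prems, of l] by simp
  also have "\<dots> = (\<Sum>i\<le>Suc l. (-1) ^ i * power_sum (j + i) * elem_sym (Suc l - i))"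
    by (subst sum.atMost_Suc_shift) (simp add: Suc.IH sum_negf)
  finally show ?case .
qed

lemma newton_identity:
  "of_nat (Suc k) * elem_sym (Suc k) = (\<Sum>i\<le>k. (-1) ^ i * power_sum (Suc i) * elem_sym (k - i))"
  using hook_sum_alternating[of 1 k] by (simp add: hook_sum_one[unfolded One_nat_def])

section \<open>Paths and cycles\<close>

text \<open>A proper colouring of a path is the word of its colours. Since
  \<open>w \<noteq> []\<close>, there is no walk of length 0; the constant term 1 of the path series
  is supplied by \<open>path_chromatic\<close>.\<close>

definition colour_walks :: "nat \<Rightarrow> nat list set" where
  "colour_walks n = {w. w \<noteq> [] \<and> length w = n \<and> set w \<subseteq> {1..} \<and> distinct_adj w}"

text \<open>The exponent \<open>k\<close> of the first colour allows the first vertex to stand for \<open>k\<close> merged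
  vertices.\<close>

definition walk_weight :: "nat \<Rightarrow> nat list \<Rightarrow> monom" where
  "walk_weight k w = Poly_Mapping.single (hd w) k + (\<Sum>c\<leftarrow>tl w. Poly_Mapping.single c 1)"

definition path_sum :: "nat \<Rightarrow> nat \<Rightarrow> mseries" where
  "path_sum n k = gen_fun (colour_walks n) (walk_weight k)"

text \<open>The cycle is cut open at one edge, which survives as the condition that the end colours
  differ.\<close>

definition cycle_sum :: "nat \<Rightarrow> nat \<Rightarrow> mseries" where
  "cycle_sum n k = gen_fun {w \<in> colour_walks n. hd w \<noteq> last w} (walk_weight k)"

lemma keys_add_nat:
  "Poly_Mapping.keys (p + q :: monom) = Poly_Mapping.keys p \<union> Poly_Mapping.keys q"
  by (auto simp: in_keys_iff lookup_add)

lemma keys_sum_list_single: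
  "Poly_Mapping.keys (\<Sum>c\<leftarrow>w. Poly_Mapping.single (c::nat) (1::nat)) = set w"
  by (induction w) (simp_all add: keys_add_nat)

lemma keys_walk_weight:
  "0 < k \<Longrightarrow> w \<noteq> [] \<Longrightarrow> Poly_Mapping.keys (walk_weight k w) = set w"
  by (cases w) (simp_all add: walk_weight_def keys_add_nat keys_sum_list_single[unfolded One_nat_def])

text \<open>The exponent of the first colour is positive, so the monomial shows all colours used,
  and finitely many words of length \<open>n\<close> have these letters.\<close>

lemma finite_fibres_walks: "0 < k \<Longrightarrow> finite_fibres (colour_walks n) (walk_weight k)"
  by (rule finite_fibresI[where F = "\<lambda>m. {w. set w \<subseteq> Poly_Mapping.keys m \<and> length w = n}"])
     (auto simp: finite_lists_length_eq keys_walk_weight colour_walks_def)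

lemma path_sum_0: "path_sum 0 k = 0"
  unfolding path_sum_def by (rule gen_fun_empty) (auto simp: colour_walks_def)

lemma cycle_sum_0: "cycle_sum 0 k = 0"
  unfolding cycle_sum_def by (rule gen_fun_empty) (auto simp: colour_walks_def)

lemma cycle_sum_1: "cycle_sum (Suc 0) k = 0"
  unfolding cycle_sum_def
  by (rule gen_fun_empty) (auto simp: colour_walks_def length_Suc_conv)

lemma path_sum_1: "path_sum (Suc 0) k = power_sum k"
  unfolding path_sum_def power_sum_def
proof (rule gen_fun_bij[where f = hd])
  show "bij_betw hd (colour_walks (Suc 0)) {1..}"
    by (rule bij_betw_byWitness[where f' = "\<lambda>c. [c]"])
       (auto simp: colour_walks_def length_Suc_conv)
qed (auto simp: walk_weight_def colour_walks_def length_Suc_conv)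

text \<open>Put a vertex of colour \<open>i\<close> and weight \<open>k\<close> before the walk. If
  \<open>i\<close> differs from the first colour, this is a longer walk; otherwise the two vertices
  merge into one of weight \<open>k + 1\<close>.\<close>

lemma power_sum_mult_path_sum:
  assumes "0 < k" "0 < n"
  shows "power_sum k * path_sum n 1 = path_sum (Suc n) k + path_sum n (Suc k)"
proof -
  let ?w = "\<lambda>(i, w). Poly_Mapping.single i k + walk_weight 1 w"
  let ?T = "{1..} \<times> colour_walks n"
  have fin: "finite_fibres ?T ?w"
    using finite_fibres_times[OF finite_fibres_single[OF assms(1)] finite_fibres_walks, of 1]
    by simp
  have "power_sum k * path_sum n 1 = gen_fun ?T ?w"
    unfolding power_sum_def path_sum_def
    by (intro gen_fun_times finite_fibres_single finite_fibres_walks assms(1)) simp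
  also have "\<dots> = gen_fun {p \<in> ?T. fst p \<noteq> hd (snd p)} ?w
      + gen_fun {p \<in> ?T. \<not> fst p \<noteq> hd (snd p)} ?w"
    by (rule gen_fun_split[OF fin])
  also have "gen_fun {p \<in> ?T. fst p \<noteq> hd (snd p)} ?w = path_sum (Suc n) k"
    unfolding path_sum_def
  proof (rule gen_fun_bij[where f = "\<lambda>(i, w). i # w"])
    show "bij_betw (\<lambda>(i, w). i # w) {p \<in> ?T. fst p \<noteq> hd (snd p)} (colour_walks (Suc n))"
      using assms(2)
      by (intro bij_betw_byWitness[where f' = "\<lambda>w. (hd w, tl w)"])
         (auto simp: colour_walks_def distinct_adj_Cons length_Suc_conv)
  next
    fix x assume "x \<in> {p \<in> ?T. fst p \<noteq> hd (snd p)}"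
    then obtain i c w where "x = (i, c # w)"
      by (auto simp: colour_walks_def neq_Nil_conv)
    then show "walk_weight k ((\<lambda>(i, w). i # w) x) = ?w x"
      by (simp add: walk_weight_def)
  qed
  also have "gen_fun {p \<in> ?T. \<not> fst p \<noteq> hd (snd p)} ?w = path_sum n (Suc k)"
    unfolding path_sum_def
  proof (rule gen_fun_bij[where f = snd])
    show "bij_betw snd {p \<in> ?T. \<not> fst p \<noteq> hd (snd p)} (colour_walks n)"
      by (intro bij_betw_byWitness[where f' = "\<lambda>w. (hd w, w)"])
         (auto simp: colour_walks_def neq_Nil_conv)
  next
    fix x assume "x \<in> {p \<in> ?T. \<not> fst p \<noteq> hd (snd p)}"
    then obtain c w where "x = (c, c # w)"
      by (auto simp: colour_walks_def neq_Nil_conv)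
    then show "walk_weight (Suc k) (snd x) = ?w x"
      by (simp add: walk_weight_def single_add[symmetric] flip: add.assoc)
  qed
  finally show ?thesis .
qed

text \<open>Either the ends of the walk have different colours, or they agree and the last vertex
  can be merged into the first, whose weight grows by one.\<close>

lemma path_sum_eq_cycle_sums:
  assumes "0 < k" "0 < n"
  shows "path_sum (Suc n) k = cycle_sum (Suc n) k + cycle_sum n (Suc k)"
proof -
  have "path_sum (Suc n) k = cycle_sum (Suc n) k
      + gen_fun {w \<in> colour_walks (Suc n). \<not> hd w \<noteq> last w} (walk_weight k)"
    unfolding path_sum_def cycle_sum_def
    by (rule gen_fun_split[OF finite_fibres_walks[OF assms(1)]])
  also have "gen_fun {w \<in> colour_walks (Suc n). \<not> hd w \<noteq> last w} (walk_weight k)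
      = cycle_sum n (Suc k)"
    unfolding cycle_sum_def
  proof (rule gen_fun_bij[symmetric, where f = "\<lambda>w. w @ [hd w]"])
    \<comment> \<open>The shortened walk closes up to a properly coloured cycle: its last colour was
      adjacent to the removed one, which equals the first colour.\<close>
    have "butlast w \<in> {w \<in> colour_walks n. hd w \<noteq> last w} \<and> w = butlast w @ [hd (butlast w)]"
      if w_in: "w \<in> {w \<in> colour_walks (Suc n). \<not> hd w \<noteq> last w}" for w
    proof -
      obtain u c where w: "w = u @ [c]"
        using w_in by (cases w rule: rev_cases) (simp_all add: colour_walks_def)
      then have "u \<noteq> []" using w_in assms(2) by (auto simp: colour_walks_def)
      then show ?thesis using w_in w
        by (auto simp: colour_walks_def distinct_adj_append_iff)
    qed
    moreover have "w @ [hd w] \<in> {w \<in> colour_walks (Suc n). \<not> hd w \<noteq> last w}"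
      if "w \<in> {w \<in> colour_walks n. hd w \<noteq> last w}" for w
      using that hd_in_set[of w] by (auto simp: colour_walks_def distinct_adj_append_iff subset_iff)
    ultimately show "bij_betw (\<lambda>w. w @ [hd w]) {w \<in> colour_walks n. hd w \<noteq> last w}
        {w \<in> colour_walks (Suc n). \<not> hd w \<noteq> last w}"
      by (intro bij_betw_byWitness[where f' = butlast]) fastforce+
  next
    fix w assume "w \<in> {w \<in> colour_walks n. hd w \<noteq> last w}"
    then obtain c u where "w = c # u" by (auto simp: colour_walks_def neq_Nil_conv)
    then show "walk_weight k (w @ [hd w]) = walk_weight (Suc k) w"
      by (simp add: walk_weight_def single_add[of c 1 k, simplified] add_ac)
  qed
  finally show ?thesis .
qed

section \<open>Expansions of paths and cycles by power sums\<close>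

definition path_chromatic :: "nat \<Rightarrow> mseries" where
  "path_chromatic n = (if n = 0 then 1 else path_sum n 1)"

lemma path_sum_Suc:
  "0 < k \<Longrightarrow> path_sum (Suc n) k = power_sum k * path_chromatic n - path_sum n (Suc k)"
  using power_sum_mult_path_sum[of k n]
  by (cases n) (simp_all add: path_chromatic_def path_sum_0 path_sum_1)

text \<open>Iteration of \<open>path_sum_Suc\<close>; the summand \<open>j\<close> has the first
  \<open>j + 1\<close> vertices merged and the rest of the path detached.\<close>

lemma path_sum_expansion:
  "0 < k \<Longrightarrow> path_sum (Suc n) k = (\<Sum>j\<le>n. (-1) ^ j * power_sum (k + j) * path_chromatic (n - j))"
proof (induction n arbitrary: k)
  case 0
  then show ?case by (simp add: path_chromatic_def path_sum_1)
next
  case (Suc n)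
  show ?case
    unfolding path_sum_Suc[OF Suc.prems, of "Suc n"]
    by (subst sum.atMost_Suc_shift) (simp add: Suc.IH sum_negf)
qed

text \<open>Iterating \<open>path_sum_eq_cycle_sums\<close> gives an alternating sum of paths with
  growing first weight, in which p_(k+j) occurs \<open>j + 1\<close> times. The iteration ends early
  because there is no cycle on one vertex, so p_(k+n) occurs only \<open>n\<close> times; this is
  the correction term.\<close>

lemma cycle_sum_expansion:
  "0 < k \<Longrightarrow> cycle_sum (Suc n) k =
    (\<Sum>j\<le>n. of_nat (Suc j) * ((-1) ^ j * power_sum (k + j)) * path_chromatic (n - j))
    - (-1) ^ n * power_sum (k + n)"
proof (induction n arbitrary: k)
  case 0
  then show ?case by (simp add: path_chromatic_def cycle_sum_1)
next
  case (Suc n)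
  let ?a = "\<lambda>j. (-1) ^ j * power_sum (k + j) * path_chromatic (Suc n - j)"
  have "cycle_sum (Suc (Suc n)) k = path_sum (Suc (Suc n)) k - cycle_sum (Suc n) (Suc k)"
    using path_sum_eq_cycle_sums[OF Suc.prems, of "Suc n"] by simp
  also have "path_sum (Suc (Suc n)) k = (\<Sum>j\<le>Suc n. ?a j)"
    by (rule path_sum_expansion[OF Suc.prems])
  \<comment> \<open>After the index shift the induction hypothesis carries the weight
    \<open>j\<close>; the path expansion adds 1 to it.\<close>
  also have "cycle_sum (Suc n) (Suc k)
      = - (\<Sum>j\<le>Suc n. of_nat j * ?a j) + (-1) ^ Suc n * power_sum (k + Suc n)"
    by (subst sum.atMost_Suc_shift) (simp add: Suc.IH sum_negf[symmetric] algebra_simps)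
  finally show ?case
    by (simp only: of_nat_Suc distrib_right mult_1_left sum.distrib) (simp add: algebra_simps)
qed

section \<open>The differential equation for the cycle series, read off coefficientwise\<close>

lemma cycle_sum_recurrence:
  "cycle_sum n 1 = (\<Sum>k\<in>{2..n - 2}. of_nat (k - 1) * elem_sym k * cycle_sum (n - k) 1)
    + of_nat (n * (n - 1)) * elem_sym n"
proof -
  \<comment> \<open>\<open>Q\<close> has no constant term, so the first summand of each convolution
    with \<open>Q\<close> vanishes and the remaining ones match the expansions with index shifted by
    one.\<close>
  define L P Q C where "L = Abs_fps elem_sym" and "P = Abs_fps path_chromatic"
    and "Q = Abs_fps (\<lambda>k. if k = 0 then 0 else (-1) ^ (k - 1) * power_sum k)"
    and "C = Abs_fps (\<lambda>n. cycle_sum n 1)"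
  have L: "fps_X * fps_deriv L = Q * L"
  proof (rule fps_ext)
    fix k show "fps_nth (fps_X * fps_deriv L) k = fps_nth (Q * L) k"
    proof (cases k)
      case (Suc m)
      have "fps_nth (Q * L) k = (\<Sum>i\<le>m. (-1) ^ i * power_sum (Suc i) * elem_sym (m - i))"
        unfolding Suc fps_mult_nth atLeast0AtMost
        by (subst sum.atMost_Suc_shift) (simp add: Q_def L_def)
      then show ?thesis using newton_identity[of m] Suc by (simp add: L_def)
    qed (simp add: Q_def)
  qed
  have P: "P = 1 + Q * P"
  proof (rule fps_ext)
    fix k show "fps_nth P k = fps_nth (1 + Q * P) k"
    proof (cases k)
      case (Suc m)
      have "fps_nth (Q * P) k = (\<Sum>i\<le>m. (-1) ^ i * power_sum (Suc i) * path_chromatic (m - i))"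
        unfolding Suc fps_mult_nth atLeast0AtMost
        by (subst sum.atMost_Suc_shift) (simp add: Q_def P_def)
      then show ?thesis using path_sum_expansion[of 1 m] Suc
        by (simp add: P_def path_chromatic_def)
    qed (simp add: Q_def P_def path_chromatic_def)
  qed
  have C: "C = fps_X * fps_deriv Q * P - Q"
  proof (rule fps_ext)
    fix k show "fps_nth C k = fps_nth (fps_X * fps_deriv Q * P - Q) k"
    proof (cases k)
      case (Suc m)
      have "fps_nth (fps_X * fps_deriv Q * P) k
          = (\<Sum>i\<le>m. of_nat (Suc i) * ((-1) ^ i * power_sum (Suc i)) * path_chromatic (m - i))"
        unfolding Suc fps_mult_nth[of "fps_X * fps_deriv Q"] atLeast0AtMost
        by (subst sum.atMost_Suc_shift) (simp add: Q_def P_def)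
      then show ?thesis using cycle_sum_expansion[of 1 m] Suc
        by (simp add: C_def Q_def)
    qed (simp add: Q_def C_def cycle_sum_0)
  qed
  \<comment> \<open>The operator t d/dt applied to Newton's identity brings in the second derivative
    of \<open>L\<close>.\<close>
  have "fps_X * fps_deriv (fps_X * fps_deriv L) = fps_X * fps_deriv (Q * L)"
    using L by simp
  then have 1: "fps_X * fps_deriv L + fps_X * fps_X * fps_deriv (fps_deriv L)
      = fps_X * fps_deriv Q * L + Q * (fps_X * fps_deriv L)"
    by (simp add: algebra_simps)
  have 2: "P * (1 - Q) = 1" using P by (simp add: algebra_simps)
  \<comment> \<open>By Newton's identity the left factor is \<open>L * (1 - Q)\<close>, and
    \<open>1 - Q\<close> cancels \<open>P\<close>.\<close>
  have "(L - fps_X * fps_deriv L) * C = L * (fps_X * fps_deriv Q * (P * (1 - Q)) - Q * (1 - Q))"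
    unfolding L C by (simp add: algebra_simps)
  also have "\<dots> = fps_X * fps_X * fps_deriv (fps_deriv L)"
    using 1 unfolding 2 L by (simp add: algebra_simps)
  finally have main: "L * C = fps_X * fps_deriv L * C + fps_X * fps_X * fps_deriv (fps_deriv L)"
    by (simp add: algebra_simps)
  let ?a = "\<lambda>k. elem_sym k * cycle_sum (n - k) 1"
  have "fps_nth (L * C) n = (\<Sum>k\<le>n. ?a k)"
    by (simp add: fps_mult_nth L_def C_def atLeast0AtMost)
  moreover have "fps_nth (fps_X * fps_deriv L * C) n = (\<Sum>k\<le>n. of_nat k * ?a k)"
  proof -
    have XL: "fps_nth (fps_X * fps_deriv L) k = of_nat k * elem_sym k" for k
      by (cases k) (simp_all add: L_def)
    show ?thesis
      unfolding fps_mult_nth[of "fps_X * fps_deriv L"] XL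
      by (simp add: C_def atLeast0AtMost mult.assoc)
  qed
  moreover have "fps_nth (fps_X * fps_X * fps_deriv (fps_deriv L)) n
      = of_nat (n * (n - 1)) * elem_sym n"
  proof (cases n)
    case (Suc m)
    then show ?thesis by (cases m) (simp_all add: L_def mult.assoc algebra_simps)
  qed simp
  ultimately have e1: "(\<Sum>k\<le>n. ?a k) = (\<Sum>k\<le>n. of_nat k * ?a k) + of_nat (n * (n - 1)) * elem_sym n"
    using main by (metis fps_add_nth)
  \<comment> \<open>The index 0 gives \<open>- cycle_sum n 1\<close>, the index 1 has weight 0, and
    for \<open>k = n - 1\<close> and \<open>k = n\<close> the cycle on 1 or 0 vertices contributes
    nothing.\<close>
  have e2: "(\<Sum>k\<le>n. of_nat k * ?a k) - (\<Sum>k\<le>n. ?a k)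
      = (\<Sum>k\<in>{2..n - 2}. of_nat (k - 1) * ?a k) - cycle_sum n 1"
  proof -
    have "(\<Sum>k\<le>n. of_nat k * ?a k) - (\<Sum>k\<le>n. ?a k) = (\<Sum>k\<le>n. (of_nat k - 1) * ?a k)"
      by (simp add: algebra_simps flip: sum_subtractf)
    also have "\<dots> = (\<Sum>k\<in>insert 0 {1..n}. (of_nat k - 1) * ?a k)"
      by (rule sum.cong) auto
    also have "\<dots> = (\<Sum>k\<in>{1..n}. (of_nat k - 1) * ?a k) - cycle_sum n 1"
      by (simp add: elem_sym_0)
    also have "(\<Sum>k\<in>{1..n}. (of_nat k - 1) * ?a k) = (\<Sum>k\<in>{2..n - 2}. (of_nat k - 1) * ?a k)"
    proof (rule sum.mono_neutral_right)
      show "\<forall>k\<in>{1..n} - {2..n - 2}. (of_nat k - 1) * ?a k = 0"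
      proof
        fix k assume "k \<in> {1..n} - {2..n - 2}"
        then have "k = 1 \<or> n - k = 0 \<or> n - k = Suc 0" by auto
        then show "(of_nat k - 1) * ?a k = 0"
          by (auto simp: cycle_sum_0 cycle_sum_1)
      qed
    qed auto
    also have "\<dots> = (\<Sum>k\<in>{2..n - 2}. of_nat (k - 1) * ?a k)"
      by (rule sum.cong) (auto simp: of_nat_diff)
    finally show ?thesis .
  qed
  \<comment> \<open>The linear algebra combining \<open>e1\<close> and \<open>e2\<close>, with the
    sums kept as opaque variables.\<close>
  have "c = s + z" if "x = y + z" "y - x = s - c" for c s x y z :: mseries
    using that by (simp add: algebra_simps)
  from this[OF e1 e2] show ?thesis by (simp only: mult.assoc)
qed

text \<open>List the colours of the vertices in order: the edges between consecutive vertices make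
  the list a walk, and the wrap-around edge separates its end colours.\<close>

lemma chromatic_sym_cycle:
  assumes "n \<ge> 2"
  shows "chromatic_sym (cycle_verts n) (cycle_edges n) = cycle_sum n 1"
proof -
  \<comment> \<open>Colourings are extensional, so the inverse map has to be restricted to the
    vertex set.\<close>
  let ?f = "\<lambda>\<kappa>. map \<kappa> [0..<n]" and ?g = "\<lambda>w. restrict (nth w) {..<n}"
  have proper: "\<kappa> \<in> proper_colorings (cycle_verts n) (cycle_edges n) \<longleftrightarrow>
      \<kappa> \<in> {..<n} \<rightarrow>\<^sub>E {1..} \<and> (\<forall>i. Suc i < n \<longrightarrow> \<kappa> i \<noteq> \<kappa> (Suc i)) \<and> \<kappa> 0 \<noteq> \<kappa> (n - 1)"
    (is "_ \<longleftrightarrow> ?R") for \<kappa>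
  proof
    assume l: "\<kappa> \<in> proper_colorings (cycle_verts n) (cycle_edges n)"
    have e: "\<kappa> i \<noteq> \<kappa> (Suc i mod n)" if "i < n" for i
    proof -
      have "{i, Suc i mod n} \<in> cycle_edges n" using that by (auto simp: cycle_edges_def)
      moreover have "i \<in> cycle_verts n" "Suc i mod n \<in> cycle_verts n"
        using that by (auto simp: cycle_verts_def)
      ultimately show ?thesis using l by (auto simp: proper_colorings_def)
    qed
    have "\<kappa> i \<noteq> \<kappa> (Suc i)" if "Suc i < n" for i
      using e[of i] that by simp
    moreover have "\<kappa> (n - 1) \<noteq> \<kappa> 0"
      using e[of "n - 1"] assms by simp
    ultimately show ?R using l by (auto simp: proper_colorings_def cycle_verts_def)
  next
    assume r: ?R
    have e: "\<kappa> i \<noteq> \<kappa> (Suc i mod n)" if "i < n" for i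
    proof (cases "Suc i = n")
      case True
      then have "i = n - 1" "Suc i mod n = 0" by auto
      then show ?thesis using r by metis
    next
      case False
      then show ?thesis using that r by simp
    qed
    have "\<kappa> u \<noteq> \<kappa> v" if uv: "{u, v} \<in> cycle_edges n" for u v
    proof -
      obtain i where "i < n" "{u, v} = {i, Suc i mod n}" using uv by (auto simp: cycle_edges_def)
      then show ?thesis using e[of i] by (metis doubleton_eq_iff)
    qed
    then show "\<kappa> \<in> proper_colorings (cycle_verts n) (cycle_edges n)"
      using r by (simp add: proper_colorings_def cycle_verts_def)
  qed
  have walk: "w \<in> {w \<in> colour_walks n. hd w \<noteq> last w} \<longleftrightarrow>
      length w = n \<and> set w \<subseteq> {1..} \<and> (\<forall>i. Suc i < n \<longrightarrow> w ! i \<noteq> w ! Suc i) \<and> w ! 0 \<noteq> w ! (n - 1)"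
    for w
  proof (cases "w = []")
    case False
    then show ?thesis
      by (auto simp: colour_walks_def distinct_adj_conv_nth hd_conv_nth last_conv_nth)
  qed (use assms in \<open>auto simp: colour_walks_def\<close>)
  have "gen_fun (proper_colorings (cycle_verts n) (cycle_edges n)) (var_prod (cycle_verts n))
      = cycle_sum n 1"
    unfolding cycle_sum_def
  proof (rule gen_fun_bij[where f = ?f])
    show "bij_betw ?f (proper_colorings (cycle_verts n) (cycle_edges n))
        {w \<in> colour_walks n. hd w \<noteq> last w}"
    proof (rule bij_betw_byWitness[where f' = ?g])
      show "\<forall>\<kappa>\<in>proper_colorings (cycle_verts n) (cycle_edges n). ?g (?f \<kappa>) = \<kappa>"
      proof
        fix \<kappa> assume "\<kappa> \<in> proper_colorings (cycle_verts n) (cycle_edges n)"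
        then have "\<kappa> \<in> extensional {..<n}"
          by (simp add: proper_colorings_def cycle_verts_def PiE_iff)
        then show "?g (?f \<kappa>) = \<kappa>"
          by (intro extensionalityI[of _ "{..<n}"]) auto
      qed
      show "\<forall>w\<in>{w \<in> colour_walks n. hd w \<noteq> last w}. ?f (?g w) = w"
        by (auto simp: colour_walks_def intro!: nth_equalityI)
      show "?f ` proper_colorings (cycle_verts n) (cycle_edges n)
          \<subseteq> {w \<in> colour_walks n. hd w \<noteq> last w}"
        unfolding subset_iff image_iff Bex_def proper walk using assms by (auto simp: PiE_iff)
      show "?g ` {w \<in> colour_walks n. hd w \<noteq> last w}
          \<subseteq> proper_colorings (cycle_verts n) (cycle_edges n)"
      proof (rule image_subsetI)
        fix w assume "w \<in> {w \<in> colour_walks n. hd w \<noteq> last w}"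
        then have w: "length w = n" "set w \<subseteq> {1..}" "\<And>i. Suc i < n \<Longrightarrow> w ! i \<noteq> w ! Suc i"
          "w ! 0 \<noteq> w ! (n - 1)"
          unfolding walk by auto
        have "1 \<le> w ! i" if "i < n" for i
          using w(1) that subsetD[OF w(2) nth_mem[of i w]] by simp
        then show "?g w \<in> proper_colorings (cycle_verts n) (cycle_edges n)"
          unfolding proper using w assms by auto
      qed
    qed
  next
    fix \<kappa> :: "nat \<Rightarrow> nat"
    have "walk_weight 1 (?f \<kappa>) = (\<Sum>c\<leftarrow>?f \<kappa>. Poly_Mapping.single c 1)"
      using assms by (simp add: walk_weight_def upt_conv_Cons)
    also have "\<dots> = var_prod (cycle_verts n) \<kappa>"
      by (simp add: var_prod_def cycle_verts_def interv_sum_list_conv_sum_set_nat comp_def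
          atLeast0LessThan)
    finally show "walk_weight 1 (?f \<kappa>) = var_prod (cycle_verts n) \<kappa>" .
  qed
  moreover have "chromatic_sym (cycle_verts n) (cycle_edges n)
      = gen_fun (proper_colorings (cycle_verts n) (cycle_edges n)) (var_prod (cycle_verts n))"
    by (rule mseries_eqI) (simp add: chromatic_sym.rep_eq mcoeff_gen_fun)
  ultimately show ?thesis by simp
qed

section \<open>Products of ribbons\<close>

lemma coarsening_Nil_iff: "coarsening J [] \<longleftrightarrow> J = []"
proof
  assume "coarsening J []"
  then obtain B where B: "concat B = []" "[] \<notin> set B" "J = map sum_list B"
    by (auto simp: coarsening_def)
  then show "J = []" by (cases B) auto
next
  assume "J = []"
  then show "coarsening J []" unfolding coarsening_def by (intro exI[of _ "[]"]) simp
qed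

lemma coarsening_singleton_iff: "coarsening J [a] \<longleftrightarrow> J = [a]"
proof
  assume "coarsening J [a]"
  then obtain B where B: "concat B = [a]" "[] \<notin> set B" "J = map sum_list B"
    by (auto simp: coarsening_def)
  then obtain b B' where [simp]: "B = b # B'" by (cases B) auto
  have "b \<noteq> []" "[] \<notin> set B'" using B by auto
  then have "b = [a]" "B' = []" using B(1)
    by (cases b; cases B'; simp)+
  then show "J = [a]" using B by simp
next
  assume "J = [a]"
  then show "coarsening J [a]"
    unfolding coarsening_def by (intro exI[of _ "[[a]]"]) simp
qed

text \<open>The first block either consists of \<open>a\<close> alone or also contains
  \<open>b\<close>; in the latter case \<open>a\<close> and \<open>b\<close> may be added
  beforehand.\<close>

lemma coarsening_Cons_Cons_iff:
  "coarsening J (a # b # I) \<longleftrightarrow>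
    (\<exists>J'. J = a # J' \<and> coarsening J' (b # I)) \<or> coarsening J ((a + b) # I)"
  (is "?L \<longleftrightarrow> ?R1 \<or> ?R2")
proof (intro iffI; (elim disjE)?)
  assume ?L
  then obtain B where B: "concat B = a # b # I" "[] \<notin> set B" "J = map sum_list B"
    by (auto simp: coarsening_def)
  then obtain x B' where [simp]: "B = x # B'" by (cases B) auto
  obtain x' where x: "x = a # x'" using B by (cases x) auto
  show "?R1 \<or> ?R2"
  proof (cases x')
    case Nil
    then show ?thesis using B x unfolding coarsening_def by auto
  next
    case (Cons y x'')
    then have "coarsening J ((a + b) # I)" using B x unfolding coarsening_def
      by (intro exI[of _ "((a + b) # x'') # B'"]) auto
    then show ?thesis ..
  qed
next
  assume ?R1
  then obtain B where "concat B = b # I" "[] \<notin> set B" "J = a # map sum_list B"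
    by (auto simp: coarsening_def)
  then show ?L unfolding coarsening_def by (intro exI[of _ "[a] # B"]) auto
next
  assume ?R2
  then obtain B where B: "concat B = (a + b) # I" "[] \<notin> set B" "J = map sum_list B"
    by (auto simp: coarsening_def)
  then obtain x B' where [simp]: "B = x # B'" by (cases B) auto
  obtain x' where x: "x = (a + b) # x'" using B by (cases x) auto
  show ?L using B x unfolding coarsening_def
    by (intro exI[of _ "(a # b # x') # B'"]) auto
qed

text \<open>Keeps the two cases of \<open>coarsening_Cons_Cons_iff\<close> disjoint: for
  \<open>0 < b\<close>, a head of at least \<open>a + b\<close> cannot be \<open>a\<close>.\<close>

lemma hd_coarsening_ge: "coarsening J (a # I) \<Longrightarrow> J \<noteq> [] \<and> a \<le> hd J"
  unfolding coarsening_def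
proof (elim exE conjE)
  fix B assume B: "concat B = a # I" "[] \<notin> set B" "J = map sum_list B"
  then obtain x B' where "B = x # B'" by (cases B) auto
  moreover from this obtain x' where "x = a # x'" using B by (cases x) auto
  ultimately show ?thesis using B by simp
qed

lemma length_le_sum_list: "0 \<notin> set I \<Longrightarrow> length I \<le> sum_list (I :: nat list)"
  by (induction I) auto

lemma coarsening_pos: "coarsening J I \<Longrightarrow> 0 \<notin> set I \<Longrightarrow> 0 \<notin> set J"
proof
  assume "coarsening J I" "0 \<notin> set I" "0 \<in> set J"
  then obtain B b where B: "concat B = I" "[] \<notin> set B" "b \<in> set B" "sum_list b = 0"
    by (auto simp: coarsening_def)
  then have "b \<noteq> []" by auto
  then obtain x where "x \<in> set b" by (cases b) auto
  moreover have "x = 0" using B(4) \<open>x \<in> set b\<close> by simp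
  ultimately have "0 \<in> set (concat B)" using B(3) by auto
  then show False using B(1) \<open>0 \<notin> set I\<close> by simp
qed

text \<open>For positive parts the length is at most the sum, so no subtraction is truncated and the
  exponents add.\<close>

lemma comp_sign_Cons:
  assumes "0 < a" "0 \<notin> set I"
  shows "comp_sign (a # I) = (-1) ^ (a - 1) * (comp_sign I :: 'a::ring_1)"
proof -
  have "sum_list (a # I) - length (a # I) = (a - 1) + (sum_list I - length I)"
    using assms length_le_sum_list[of I] by simp
  then show ?thesis by (simp add: comp_sign_def power_add)
qed

text \<open>Signs are central; in the noncommutative ring \<open>nsym\<close> this is what lets them
  move past other factors.\<close>

lemma minus_one_power_commute: "(-1) ^ k * x = x * (-1 :: 'a::ring_1) ^ k"
  by (cases "even k") simp_all

lemma comp_sign_commute: "comp_sign I * x = x * (comp_sign I :: 'a::ring_1)"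
  by (simp add: comp_sign_def minus_one_power_commute)

lemma minus_one_power_square: "(-1) ^ k * ((-1) ^ k * x) = (x :: 'a::ring_1)"
  by (cases "even k") simp_all

section \<open>Recursion and product rule for ribbons\<close>

lemma ribbon_singleton: "ribbon [a] = Sn a"
  by (simp add: ribbon_def coarsening_singleton_iff comp_sign_def S_comp_def
      minus_one_power_square)

lemma ribbon_Nil: "ribbon [] = 1"
  by (simp add: ribbon_def coarsening_Nil_iff comp_sign_def S_comp_def)

text \<open>Split the defining sum by the first block. If it is \<open>a\<close>, then
  \<open>Sn a\<close> factors out on the left; the other coarsenings are those of
  \<open>(a + b) # I\<close>, a list with one part fewer and hence of opposite sign.\<close>

lemma ribbon_Cons_Cons:
  assumes "0 < a" "0 < b" "0 \<notin> set I"
  shows "ribbon (a # b # I) = Sn a * ribbon (b # I) - ribbon ((a + b) # I)"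
proof -
  let ?G = "\<lambda>I. \<Sum>J | coarsening J I. comp_sign J * S_comp J"
  have "{J. coarsening J (a # b # I)}
      = (#) a ` {J. coarsening J (b # I)} \<union> {J. coarsening J ((a + b) # I)}"
    by (auto simp: coarsening_Cons_Cons_iff)
  moreover have "(#) a ` {J. coarsening J (b # I)} \<inter> {J. coarsening J ((a + b) # I)} = {}"
    using hd_coarsening_ge assms(2) by fastforce
  ultimately have "?G (a # b # I)
      = (\<Sum>J\<in>(#) a ` {J. coarsening J (b # I)}. comp_sign J * S_comp J) + ?G ((a + b) # I)"
    by (simp add: sum.union_disjoint finite_coarsenings)
  also have "(\<Sum>J\<in>(#) a ` {J. coarsening J (b # I)}. comp_sign J * S_comp J)
      = (\<Sum>J | coarsening J (b # I). comp_sign (a # J) * S_comp (a # J))"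
    by (simp add: sum.reindex)
  also have "\<dots> = (\<Sum>J | coarsening J (b # I). (-1) ^ (a - 1) * (Sn a * (comp_sign J * S_comp J)))"
  proof (rule sum.cong)
    fix J assume "J \<in> {J. coarsening J (b # I)}"
    then have "0 \<notin> set J" using coarsening_pos assms by fastforce
    then show "comp_sign (a # J) * S_comp (a # J)
        = (-1) ^ (a - 1) * (Sn a * (comp_sign J * S_comp J))"
      using assms(1) comp_sign_commute[of J "Sn a"]
      by (simp add: comp_sign_Cons S_comp_def mult.assoc) (simp flip: mult.assoc)
  qed simp
  also have "\<dots> = (-1) ^ (a - 1) * (Sn a * ?G (b # I))"
    by (simp add: sum_distrib_left)
  finally have G: "?G (a # b # I) = (-1) ^ (a - 1) * (Sn a * ?G (b # I)) + ?G ((a + b) # I)" .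
  have s1: "comp_sign (a # b # I) = (-1) ^ (a - 1) * (comp_sign (b # I) :: nsym)"
    using assms by (intro comp_sign_Cons) auto
  have s2: "comp_sign (a # b # I) = - (comp_sign ((a + b) # I) :: nsym)"
  proof -
    obtain a' b' where "a = Suc a'" "b = Suc b'" using assms by (metis gr0_implies_Suc)
    then show ?thesis using assms by (simp add: comp_sign_Cons power_add mult.assoc)
  qed
  have "ribbon (a # b # I) = comp_sign (a # b # I) * ((-1) ^ (a - 1) * (Sn a * ?G (b # I)))
      + comp_sign (a # b # I) * ?G ((a + b) # I)"
    unfolding ribbon_def[of "a # b # I"] G by (rule distrib_left)
  also have "comp_sign (a # b # I) * ((-1) ^ (a - 1) * (Sn a * ?G (b # I)))
      = Sn a * ribbon (b # I)"
  proof -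
    have "comp_sign (a # b # I) * ((-1) ^ (a - 1) * (Sn a * ?G (b # I)))
        = (-1) ^ (a - 1) * ((comp_sign (b # I) * (-1) ^ (a - 1)) * (Sn a * ?G (b # I)))"
      unfolding s1 by (simp only: mult.assoc)
    also have "\<dots> = (-1) ^ (a - 1) * ((-1) ^ (a - 1) * ((comp_sign (b # I) * Sn a) * ?G (b # I)))"
      unfolding comp_sign_commute[of "b # I" "(-1) ^ (a - 1)"] by (simp only: mult.assoc)
    also have "\<dots> = Sn a * ribbon (b # I)"
      unfolding minus_one_power_square comp_sign_commute[of "b # I" "Sn a"]
      by (simp only: ribbon_def mult.assoc)
    finally show ?thesis .
  qed
  also have "comp_sign (a # b # I) * ?G ((a + b) # I) = - ribbon ((a + b) # I)"
    unfolding s2 ribbon_def by simp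
  finally show ?thesis by simp
qed

text \<open>For \<open>I = []\<close> this is \<open>ribbon_Cons_Cons\<close>. In general that
  recursion removes the first part of the left factor, and associativity reduces the product to
  shorter ones.\<close>

lemma ribbon_mult:
  assumes "0 < a" "0 < b" "0 \<notin> set I" "0 \<notin> set J"
  shows "ribbon (I @ [a]) * ribbon (b # J) = ribbon (I @ [a, b] @ J) + ribbon (I @ [a + b] @ J)"
  using assms
\<comment> \<open>The recursion also produces \<open>(i + j) # K\<close>, which is not a tail of
  \<open>I\<close>, so the induction runs over the length.\<close>
proof (induction "length I" arbitrary: I a)
  case 0
  then show ?case by (simp add: ribbon_singleton ribbon_Cons_Cons)
next
  case (Suc n)
  then obtain i I' where I: "I = i # I'" by (cases I) auto
  show ?case
  proof (cases I')
    case Nil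
    then show ?thesis
      using Suc.prems I by (simp add: ribbon_Cons_Cons ribbon_singleton algebra_simps)
  next
    case (Cons j K)
    have 1: "ribbon ((j # K) @ [a]) * ribbon (b # J)
        = ribbon ((j # K) @ [a, b] @ J) + ribbon ((j # K) @ [a + b] @ J)"
      using Suc I Cons by (intro Suc.hyps(1)) auto
    have 2: "ribbon (((i + j) # K) @ [a]) * ribbon (b # J)
        = ribbon (((i + j) # K) @ [a, b] @ J) + ribbon (((i + j) # K) @ [a + b] @ J)"
      using Suc I Cons by (intro Suc.hyps(1)) auto
    show ?thesis
      using 1 2 Suc.prems I Cons
      by (simp add: ribbon_Cons_Cons left_diff_distrib mult.assoc) (simp add: distrib_left)
  qed
qed

section \<open>Ribbons of ones are the generators\<close>

lemma Sn_0: "Sn 0 = 1"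
  by (simp add: Sn_def)

text \<open>Each product is a sum of two neighbouring hook ribbons, and the alternating sum
  telescopes.\<close>

lemma ribbon_ones_alternating:
  "(\<Sum>i\<le>m. (-1) ^ i * (Sn (Suc k + m - i) * ribbon (replicate i 1)))
    = (-1) ^ m * ribbon (Suc k # replicate m 1)"
proof (induction m arbitrary: k)
  case 0
  then show ?case by (simp add: ribbon_singleton ribbon_Nil)
next
  case (Suc m)
  have "Sn (Suc k) * ribbon (replicate (Suc m) 1)
      = ribbon (Suc k # replicate (Suc m) 1) + ribbon (Suc (Suc k) # replicate m 1)"
    using ribbon_Cons_Cons[of "Suc k" 1 "replicate m 1"] by simp
  then show ?case using Suc.IH[of "Suc k"] by (simp add: algebra_simps)
qed

text \<open>Both sequences satisfy the same convolution identity with the \<open>Sn\<close>, which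
  determines each term from the earlier ones: for \<open>Lam\<close> it is a coefficient of S(t)
  \<lambda>(-t) = 1, for the ribbons it is the telescoping sum with \<open>k = 0\<close>.\<close>

lemma ribbon_ones: "ribbon (replicate n 1) = Lam n"
proof (induction n rule: less_induct)
  case (less n)
  show ?case
  proof (cases n)
    case 0
    then show ?thesis by (simp add: ribbon_Nil Lam_def)
  next
    case (Suc m)
    have "(\<Sum>i\<le>m. (-1) ^ i * (Sn (n - i) * ribbon (replicate i 1)))
        = (-1) ^ m * ribbon (replicate n 1)"
      using ribbon_ones_alternating[where k = 0 and m = m] Suc by simp
    then have 1: "(\<Sum>i\<le>m. Sn (n - i) * ((-1) ^ i * Lam i)) = (-1) ^ m * ribbon (replicate n 1)"
      using less Suc by (simp add: minus_one_power_commute mult.assoc)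
    have "0 = fps_nth (Abs_fps Sn * lam_neg) n"
      using Suc by (simp add: lam_neg_inverse)
    also have "\<dots> = (\<Sum>i\<le>n. Sn (n - i) * ((-1) ^ i * Lam i))"
      unfolding fps_mult_nth lam_neg_def fps_nth_Abs_fps atMost_atLeast0[symmetric]
      by (rule sum.reindex_bij_witness[where i = "\<lambda>i. n - i" and j = "\<lambda>i. n - i"]) auto
    also have "\<dots> = (-1) ^ m * ribbon (replicate n 1) - (-1) ^ m * Lam n"
      using 1 Suc by (simp add: Sn_0)
    finally have "(-1) ^ m * ribbon (replicate n 1) = (-1) ^ m * Lam n" by simp
    then show ?thesis by (metis minus_one_power_square)
  qed
qed

section \<open>The ribbon side\<close>

lemma leading_ones_eq: "leading_ones I = length (takeWhile (\<lambda>i. i = 1) I)"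
  unfolding leading_ones_def
proof (rule Greatest_equality)
  show "length (takeWhile (\<lambda>i. i = 1) I) \<le> length I
      \<and> (\<forall>j<length (takeWhile (\<lambda>i. i = 1) I). I ! j = 1)"
  proof (intro conjI allI impI)
    fix j assume "j < length (takeWhile (\<lambda>i. i = 1) I)"
    then show "I ! j = 1" using nth_mem set_takeWhileD takeWhile_nth by fastforce
  qed (rule length_takeWhile_le)
next
  fix r assume r: "r \<le> length I \<and> (\<forall>j<r. I ! j = 1)"
  show "r \<le> length (takeWhile (\<lambda>i. i = 1) I)"
  proof (rule ccontr)
    assume "\<not> r \<le> length (takeWhile (\<lambda>i. i = 1) I)"
    then have "length (takeWhile (\<lambda>i. i = 1) I) < r" by simp
    with r nth_length_takeWhile[of "\<lambda>i. i = 1" I] show False by auto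
  qed
qed

text \<open>The subtracted 1 is the coefficient of the separate term -R_(1^n), present exactly when
  all parts are 1.\<close>

definition cycle_coeff :: "nat list \<Rightarrow> rat" where
  "cycle_coeff I = 2 ^ count_list I 1 * (1 - 1 / 2 ^ leading_ones I) - (if set I \<subseteq> {1} then 1 else 0)"

lemma ones_eq_replicate: "set I \<subseteq> {1} \<Longrightarrow> I = replicate (length I) 1"
  by (induction I) auto

lemma cycle_coeff_ones: "cycle_coeff (replicate n 1) = 2 ^ n - 2"
proof -
  have "takeWhile (\<lambda>i. i = 1) (replicate n (1::nat)) = replicate n 1"
    by (simp add: takeWhile_eq_all_conv)
  moreover have "count_list (replicate n (1::nat)) 1 = n"
    by (induction n) auto
  ultimately show ?thesis
    by (simp only: cycle_coeff_def leading_ones_eq length_replicate) (auto simp: field_simps)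
qed

text \<open>A further 1 doubles the power of two and leaves the leading ones alone unless all parts
  are 1; in that case the values are 2^n - 2 and 2^(n+1) - 2, which accounts for the extra
  2.\<close>

lemma cycle_coeff_snoc_1:
  "cycle_coeff (I @ [1]) = 2 * cycle_coeff I + (if set I \<subseteq> {1} then 2 else 0)"
proof (cases "set I \<subseteq> {1}")
  case True
  then have I: "I = replicate (length I) 1" by (rule ones_eq_replicate)
  then have "I @ [1] = replicate (Suc (length I)) 1"
    by (metis replicate_Suc replicate_append_same)
  then have "cycle_coeff (I @ [1]) = 2 ^ Suc (length I) - 2" by (simp only: cycle_coeff_ones)
  moreover have "cycle_coeff I = 2 ^ length I - 2" using I cycle_coeff_ones by metis
  ultimately show ?thesis using True by simp
next
  case False
  then have "takeWhile (\<lambda>i. i = 1) (I @ [1]) = takeWhile (\<lambda>i. i = 1) I"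
    by (auto simp: takeWhile_append)
  then show ?thesis using False by (simp add: cycle_coeff_def leading_ones_eq)
qed

text \<open>Only \<open>I\<close> = 1^n needs care: the inserted 2 ends the run of leading ones
  after \<open>n\<close>, giving 2^(n+1) (1 - 1/2^n) = 2^(n+1) - 2, which is also the value at
  1^(n+1) thanks to the subtracted 1.\<close>

lemma cycle_coeff_insert_2: "cycle_coeff (I @ [2, 1]) = cycle_coeff (I @ [1])"
proof (cases "set I \<subseteq> {1}")
  case True
  then have I: "I = replicate (length I) 1" by (rule ones_eq_replicate)
  then have "I @ [1] = replicate (Suc (length I)) 1"
    by (metis replicate_Suc replicate_append_same)
  then have 1: "cycle_coeff (I @ [1]) = 2 ^ Suc (length I) - 2" by (simp only: cycle_coeff_ones)
  have "takeWhile (\<lambda>i. i = 1) (I @ [2, 1]) = I"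
    using True by (subst takeWhile_append2) auto
  moreover have "count_list I 1 = length I" using True by (induction I) auto
  ultimately show ?thesis unfolding 1
    by (simp add: cycle_coeff_def leading_ones_eq field_simps)
next
  case False
  then have "takeWhile (\<lambda>i. i = 1) (I @ zs) = takeWhile (\<lambda>i. i = 1) I" for zs
    by (auto simp: takeWhile_append)
  then show ?thesis using False by (simp add: cycle_coeff_def leading_ones_eq)
qed

section \<open>Compositions into parts 1 and 2, the possible inner parts\<close>

definition compositions12 :: "nat \<Rightarrow> nat list set" where
  "compositions12 m = {M. set M \<subseteq> {1, 2} \<and> sum_list M = m}"

lemma compositions12_subset: "compositions12 m \<subseteq> compositions m"
  by (auto simp: compositions12_def compositions_def)

lemma finite_compositions12: "finite (compositions12 m)"
  using compositions12_subset finite_compositions by (rule finite_subset)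

lemma zero_notin_compositions12: "M \<in> compositions12 m \<Longrightarrow> 0 \<notin> set M"
  by (auto simp: compositions12_def)

lemma compositions12_ones_iff:
  assumes "M \<in> compositions12 m"
  shows "set M \<subseteq> {1} \<longleftrightarrow> M = replicate m 1"
proof
  assume "set M \<subseteq> {1}"
  then obtain k where k: "M = replicate k 1" using ones_eq_replicate by blast
  then show "M = replicate m 1" using assms by (simp add: compositions12_def sum_list_replicate)
qed auto

lemma replicate_in_compositions12: "replicate m 1 \<in> compositions12 m"
  by (auto simp: compositions12_def sum_list_replicate)

lemma compositions12_0: "compositions12 0 = {[]}"
proof -
  have "M = []" if "set M \<subseteq> {1, 2}" "sum_list M = 0" for M :: "nat list"
    using that by (cases M) auto
  then show ?thesis by (auto simp: compositions12_def)
qed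

lemma compositions12_snoc:
  "M @ [x] \<in> compositions12 m \<longleftrightarrow> x \<in> {1, 2} \<and> x \<le> m \<and> M \<in> compositions12 (m - x)"
  by (auto simp: compositions12_def)

lemma compositions12_1: "compositions12 (Suc 0) = {[1]}"
proof -
  have "M = [1]" if M: "M \<in> compositions12 (Suc 0)" for M
  proof (cases M rule: rev_cases)
    case Nil
    then show ?thesis using M by (simp add: compositions12_def)
  next
    case (snoc K x)
    then show ?thesis using M by (auto simp: compositions12_snoc compositions12_0)
  qed
  then show ?thesis by (auto simp: compositions12_def)
qed

lemma compositions12_Suc_Suc:
  "compositions12 (Suc (Suc m)) =
    (\<lambda>M. M @ [1]) ` compositions12 (Suc m) \<union> (\<lambda>M. M @ [2]) ` compositions12 m"
  (is "?L = ?R")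
proof (rule set_eqI)
  fix M
  show "M \<in> ?L \<longleftrightarrow> M \<in> ?R"
  proof (cases M rule: rev_cases)
    case Nil
    then show ?thesis by (auto simp: compositions12_def)
  next
    case (snoc K x)
    then show ?thesis by (auto simp: compositions12_snoc image_iff)
  qed
qed

section \<open>Weighted ribbon sums and their recurrence\<close>

definition rib :: "nat list \<Rightarrow> mseries" where
  "rib I = comm_image (ribbon I)"

lemma rib_ones: "rib (replicate n 1) = elem_sym n"
  by (simp only: rib_def ribbon_ones comm_image_Lam)

text \<open>In the notation above, \<open>ribbon_sum1 m k\<close> is the image of $V(m + 2, k)$: the outer ones of
  $I = 1 \cdot M \cdot 1$ are not counted in \<open>m\<close>.\<close>

definition ribbon_sum1 :: "nat \<Rightarrow> nat \<Rightarrow> mseries" where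
  "ribbon_sum1 m k = (\<Sum>M\<in>compositions12 m.
    mconst (cycle_coeff (1 # M @ [1])) * rib (1 # M @ 1 # replicate k 1))"

text \<open>The companion in which the final 1 has been merged with the first of the
  \<open>Suc k\<close> appended ones, as happens in the ribbon product.\<close>

definition ribbon_sum2 :: "nat \<Rightarrow> nat \<Rightarrow> mseries" where
  "ribbon_sum2 m k = (\<Sum>M\<in>compositions12 m.
    mconst (cycle_coeff (1 # M @ [1])) * rib (1 # M @ 2 # replicate k 1))"

text \<open>Apply \<open>ribbon_mult\<close> to each term, with e_(k+1) as the image of the ribbon
  of 1^(k+1).\<close>

lemma ribbon_sum_mult_elem_sym:
  "ribbon_sum1 m 0 * elem_sym (Suc k) = ribbon_sum1 m (Suc k) + ribbon_sum2 m k"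
proof -
  have "rib (1 # M @ [1]) * elem_sym (Suc k)
      = rib (1 # M @ 1 # replicate (Suc k) 1) + rib (1 # M @ 2 # replicate k 1)"
    if "M \<in> compositions12 m" for M
  proof -
    have "ribbon ((1 # M) @ [1]) * ribbon (1 # replicate k 1)
        = ribbon ((1 # M) @ [1, 1] @ replicate k 1) + ribbon ((1 # M) @ [1 + 1] @ replicate k 1)"
      using zero_notin_compositions12[OF that] by (intro ribbon_mult) auto
    then have "rib (1 # M @ [1]) * rib (replicate (Suc k) 1)
      = rib (1 # M @ 1 # replicate (Suc k) 1) + rib (1 # M @ 2 # replicate k 1)"
      by (simp add: rib_def flip: comm_image_mult comm_image_add) (simp add: numeral_2_eq_2)
    then show ?thesis by (simp only: rib_ones)
  qed
  then show ?thesis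
    by (simp add: ribbon_sum1_def ribbon_sum2_def sum_distrib_right mult.assoc distrib_left
        sum.distrib)
qed

lemma rib_hook_ones: "rib (1 # replicate m 1 @ 1 # replicate k 1) = elem_sym (m + k + 2)"
proof -
  have "1 # replicate m 1 @ 1 # replicate k 1 = replicate (m + k + 2) (1::nat)"
    by (simp add: replicate_add replicate_app_Cons_same)
  then show ?thesis by (simp only: rib_ones)
qed

lemma mconst_2: "mconst 2 = 2"
  using mconst_add[of 1 1] by (simp add: mconst_1)

text \<open>Split by the last part of \<open>M\<close> and let the outer 1 join the appended ones,
  so \<open>k\<close> grows by one. A last part 2 keeps the coefficient, a last part 1 doubles it,
  and the all-ones composition adds the elementary term.\<close>

lemma ribbon_sum1_Suc_Suc:
  "ribbon_sum1 (Suc (Suc m)) k =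
    2 * ribbon_sum1 (Suc m) (Suc k) + 2 * elem_sym (m + k + 4) + ribbon_sum2 m (Suc k)"
proof -
  let ?f = "\<lambda>M. mconst (cycle_coeff (1 # M @ [1])) * rib (1 # M @ 1 # replicate k 1)"
  let ?g = "\<lambda>M. rib (1 # M @ 1 # replicate (Suc k) 1)"
  have "ribbon_sum1 (Suc (Suc m)) k
      = (\<Sum>M\<in>compositions12 (Suc m). ?f (M @ [1])) + (\<Sum>M\<in>compositions12 m. ?f (M @ [2]))"
    unfolding ribbon_sum1_def compositions12_Suc_Suc
    by (subst sum.union_disjoint)
       (auto simp: finite_compositions12 sum.reindex inj_on_def)
  also have "(\<Sum>M\<in>compositions12 m. ?f (M @ [2])) = ribbon_sum2 m (Suc k)"
  proof -
    have "cycle_coeff (1 # (M @ [2]) @ [1]) = cycle_coeff (1 # M @ [1])" for M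
      using cycle_coeff_insert_2[of "1 # M"] by simp
    then show ?thesis by (simp only: ribbon_sum2_def) simp
  qed
  also have "(\<Sum>M\<in>compositions12 (Suc m). ?f (M @ [1]))
      = (\<Sum>M\<in>compositions12 (Suc m). 2 * (mconst (cycle_coeff (1 # M @ [1])) * ?g M)
          + (if M = replicate (Suc m) 1 then 2 * ?g M else 0))"
  proof (rule sum.cong)
    fix M assume M: "M \<in> compositions12 (Suc m)"
    have "set (1 # M @ [1]) \<subseteq> {1} \<longleftrightarrow> M = replicate (Suc m) 1"
      using compositions12_ones_iff[OF M] by simp
    then have "cycle_coeff (1 # (M @ [1]) @ [1])
        = 2 * cycle_coeff (1 # M @ [1]) + (if M = replicate (Suc m) 1 then 2 else 0)"
      using cycle_coeff_snoc_1[of "1 # M @ [1]"] by (simp only: append.simps append_assoc)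
    then show "?f (M @ [1]) = 2 * (mconst (cycle_coeff (1 # M @ [1])) * ?g M)
          + (if M = replicate (Suc m) 1 then 2 * ?g M else 0)"
      by (simp only: mconst_add mconst_mult distrib_right mult.assoc append.simps append_assoc
          replicate.simps)
         (simp add: mconst_0 mconst_2)
  qed simp
  also have "\<dots> = 2 * ribbon_sum1 (Suc m) (Suc k) + 2 * ?g (replicate (Suc m) 1)"
    using replicate_in_compositions12[of "Suc m"]
    by (simp only: sum.distrib ribbon_sum1_def sum_distrib_left sum.delta finite_compositions12
        if_True)
  also have "?g (replicate (Suc m) 1) = elem_sym (m + k + 4)"
    unfolding rib_hook_ones by (simp add: add_ac numeral_eq_Suc)
  finally show ?thesis by simp
qed

text \<open>In this lemma and the next, the only composition consists of ones; the constants are 2^2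
  - 2 and 2^3 - 2.\<close>

lemma ribbon_sum1_0: "ribbon_sum1 0 k = 2 * elem_sym (k + 2)"
  using rib_hook_ones[of 0 k] cycle_coeff_ones[of 2]
  by (simp add: ribbon_sum1_def compositions12_0 mconst_2 numeral_2_eq_2)

lemma ribbon_sum1_1: "ribbon_sum1 (Suc 0) k = 6 * elem_sym (k + 3)"
proof -
  have "mconst 6 = 6"
    using mconst_mult[of 2 3] mconst_add[of 1 2] by (simp add: mconst_2 mconst_1)
  then show ?thesis
    using rib_hook_ones[of 1 k] cycle_coeff_ones[of 3]
    by (simp add: ribbon_sum1_def compositions12_1 numeral_eq_Suc)
qed

text \<open>\<open>ribbon_sum2\<close> is eliminated between the recursion and the product
  rule.\<close>

lemma ribbon_sum1_second_difference:
  "ribbon_sum1 (Suc (Suc m)) k - 2 * ribbon_sum1 (Suc m) (Suc k) + ribbon_sum1 m (Suc (Suc k))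
    = ribbon_sum1 m 0 * elem_sym (k + 2) + 2 * elem_sym (m + k + 4)"
  using ribbon_sum_mult_elem_sym[of m "Suc k"] by (simp add: ribbon_sum1_Suc_Suc)

text \<open>Inverts the second difference: summation by parts, done twice, leaves the weights
  \<open>j + 1\<close> and two boundary values.\<close>

lemma sum_by_parts_second_difference:
  fixes W :: "nat \<Rightarrow> 'a::comm_ring_1"
  shows "W 0 = (\<Sum>j<i. of_nat (Suc j) * (W j - 2 * W (Suc j) + W (Suc (Suc j))))
    + of_nat (Suc i) * W i - of_nat i * W (Suc i)"
  by (induction i) (simp_all add: algebra_simps)

lemma ribbon_sum1_recurrence:
  "ribbon_sum1 m 0 = (\<Sum>k\<in>{2..m}. of_nat (k - 1) * elem_sym k * ribbon_sum1 (m - k) 0)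
    + of_nat ((m + 2) * (m + 1)) * elem_sym (m + 2)"
proof (cases m)
  case 0
  then show ?thesis by (simp add: ribbon_sum1_0)
next
  case (Suc l)
  \<comment> \<open>\<open>W\<close> follows the line of constant total size; the boundary values
    \<open>W l\<close> and \<open>W (Suc l)\<close> are the initial cases with first argument 1 and
    0.\<close>
  define W where "W j = ribbon_sum1 (m - j) j" for j
  let ?e = "elem_sym (m + 2)"
  have D: "W j - 2 * W (Suc j) + W (Suc (Suc j))
      = ribbon_sum1 (m - (j + 2)) 0 * elem_sym (j + 2) + 2 * ?e" if "j < l" for j
  proof -
    define i where "i = m - (j + 2)"
    have "m = i + j + 2" using that Suc by (simp add: i_def)
    moreover from this have "elem_sym (i + j + 4) = ?e" by (simp add: numeral_eq_Suc)
    ultimately show ?thesis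
      using ribbon_sum1_second_difference[of i j] by (simp add: W_def)
  qed
  have "ribbon_sum1 m 0 = W 0" by (simp add: W_def)
  also have "\<dots> = (\<Sum>j<l. of_nat (Suc j) * (W j - 2 * W (Suc j) + W (Suc (Suc j))))
      + of_nat (Suc l) * W l - of_nat l * W (Suc l)"
    by (rule sum_by_parts_second_difference)
  also have "W l = 6 * ?e"
    using Suc by (simp add: W_def ribbon_sum1_1 numeral_eq_Suc)
  also have "W (Suc l) = 2 * ?e"
    using Suc by (simp add: W_def ribbon_sum1_0)
  also have "(\<Sum>j<l. of_nat (Suc j) * (W j - 2 * W (Suc j) + W (Suc (Suc j))))
      = (\<Sum>j<l. of_nat (Suc j) * elem_sym (j + 2) * ribbon_sum1 (m - (j + 2)) 0)
        + (\<Sum>j<l. 2 * of_nat (Suc j)) * ?e"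
    unfolding sum_distrib_right sum.distrib[symmetric]
  proof (rule sum.cong)
    fix j assume "j \<in> {..<l}"
    then have "j < l" by simp
    show "of_nat (Suc j) * (W j - 2 * W (Suc j) + W (Suc (Suc j)))
        = of_nat (Suc j) * elem_sym (j + 2) * ribbon_sum1 (m - (j + 2)) 0
          + 2 * of_nat (Suc j) * ?e"
      unfolding D[OF \<open>j < l\<close>] by (simp only: distrib_left mult_ac)
  qed simp
  also have "(\<Sum>j<l. 2 * of_nat (Suc j) :: mseries) = of_nat (l * (l + 1))"
    by (induction l) (simp_all add: algebra_simps)
  also have "(\<Sum>j<l. of_nat (Suc j) * elem_sym (j + 2) * ribbon_sum1 (m - (j + 2)) 0)
      = (\<Sum>k\<in>{2..m}. of_nat (k - 1) * elem_sym k * ribbon_sum1 (m - k) 0)"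
    using Suc
    by (intro sum.reindex_bij_witness[where i = "\<lambda>k. k - 2" and j = "\<lambda>j. j + 2"])
       (auto simp: Suc_diff_Suc numeral_2_eq_2)
  \<comment> \<open>The multiples of \<open>?e\<close> add up to l(l+1) + 6(l+1) - 2l = (l+2)(l+3),
    which is (m+1)(m+2).\<close>
  finally show ?thesis using Suc by (simp add: algebra_simps)
qed

text \<open>With \<open>n = m + 2\<close> the two recurrences coincide, and since
  \<open>k \<ge> 2\<close> they only refer to smaller indices.\<close>

lemma ribbon_sum1_eq_cycle_sum: "ribbon_sum1 m 0 = cycle_sum (m + 2) 1"
proof (induction m rule: less_induct)
  case (less m)
  have "cycle_sum (m + 2 - k) 1 = ribbon_sum1 (m - k) 0" if "k \<in> {2..m}" for k
    using less.IH[of "m - k"] that by (simp add: Suc_diff_le)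
  then show ?case
    by (subst ribbon_sum1_recurrence, subst cycle_sum_recurrence) simp
qed

section \<open>Translation to the sum over compositions of n\<close>

lemma comm_image_sum: "comm_image (\<Sum>i\<in>A. F i) = (\<Sum>i\<in>A. comm_image (F i))"
  by (induction A rule: infinite_finite_induct) (simp_all add: comm_image_0 comm_image_add)

lemma comm_image_diff: "comm_image (F - G) = comm_image F - comm_image G"
  using comm_image_add[of "F - G" G] by simp

lemma compositions_hd_last:
  assumes "n \<ge> 2"
  shows "{I. I \<in> compositions n \<and> hd I = 1 \<and> last I = 1 \<and> (\<forall>i\<in>set (butlast (tl I)). i \<le> 2)}
    = (\<lambda>M. 1 # M @ [1]) ` compositions12 (n - 2)" (is "?L = ?R")
proof (intro equalityI subsetI)
  fix I assume I: "I \<in> ?L"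
  obtain K where K: "I = 1 # K"
    using I assms by (cases I) (auto simp: compositions_def)
  \<comment> \<open>\<open>K\<close> is nonempty because a single part 1 does not reach the sum
    \<open>n \<ge> 2\<close>; the first and last parts are therefore different entries.\<close>
  obtain M where M: "K = M @ [1]"
    using I assms K by (cases K rule: rev_cases) (auto simp: compositions_def)
  have "x \<in> {1, 2}" if "x \<in> set M" for x
  proof -
    have "0 < x" "x \<le> 2" using I K M that by (auto simp: compositions_def)
    then show ?thesis by auto
  qed
  then have "M \<in> compositions12 (n - 2)"
    using I K M by (auto simp: compositions_def compositions12_def)
  then show "I \<in> ?R" using K M by simp
next
  fix I assume "I \<in> ?R"
  then obtain M where "I = 1 # M @ [1]" "set M \<subseteq> {1, 2}" "sum_list M = n - 2"
    by (auto simp: compositions12_def)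
  then show "I \<in> ?L" using assms by (auto simp: compositions_def butlast_append)
qed

theorem theorem3p2:
  fixes n :: nat
  assumes "n \<ge> 2"
  shows "nc_analog
    ((\<Sum>I | I \<in> compositions n \<and> hd I = 1 \<and> last I = 1 \<and> (\<forall>i\<in>set (butlast (tl I)). i \<le> 2).
        nsym_scale (2 ^ count_list I 1 * (1 - 1 / 2 ^ leading_ones I)) (ribbon I))
      - ribbon (replicate n 1))
    (chromatic_sym (cycle_verts n) (cycle_edges n))"
proof -
  let ?c = "\<lambda>I. 2 ^ count_list I 1 * (1 - 1 / 2 ^ leading_ones I) :: rat"
  let ?h = "\<lambda>M. 1 # M @ [1 :: nat]"
  define ones where "ones = replicate (n - 2) (1 :: nat)"
  have ones: "ones \<in> compositions12 (n - 2)"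
    unfolding ones_def by (rule replicate_in_compositions12)
  have "?h ones = replicate n 1"
  proof -
    have "?h ones = replicate (Suc (Suc (n - 2))) 1"
      by (simp add: ones_def replicate_append_same)
    then show ?thesis using assms by (simp add: Suc_diff_Suc numeral_2_eq_2)
  qed
  have ones_iff: "set (?h M) \<subseteq> {1} \<longleftrightarrow> M = ones" if "M \<in> compositions12 (n - 2)" for M
    using compositions12_ones_iff[OF that] by (simp add: ones_def)
  have "comm_image (\<Sum>I | I \<in> compositions n \<and> hd I = 1 \<and> last I = 1
        \<and> (\<forall>i\<in>set (butlast (tl I)). i \<le> 2). nsym_scale (?c I) (ribbon I))
      = (\<Sum>M\<in>compositions12 (n - 2). mconst (?c (?h M)) * rib (?h M))"
    unfolding compositions_hd_last[OF assms]
    by (subst sum.reindex) (auto simp: inj_on_def comm_image_sum comm_image_scale rib_def)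
  \<comment> \<open>Passing to \<open>cycle_coeff\<close> splits off one copy of R_(1^n), which the
    separate term of the claim cancels at the end.\<close>
  also have "\<dots> = (\<Sum>M\<in>compositions12 (n - 2). mconst (cycle_coeff (?h M)) * rib (?h M)
      + (if M = ones then rib (?h M) else 0))"
  proof (rule sum.cong)
    fix M assume "M \<in> compositions12 (n - 2)"
    then have "?c (?h M) = cycle_coeff (?h M) + (if M = ones then 1 else 0)"
      using ones_iff[of M] by (simp only: cycle_coeff_def)
    then show "mconst (?c (?h M)) * rib (?h M) = mconst (cycle_coeff (?h M)) * rib (?h M)
      + (if M = ones then rib (?h M) else 0)"
      by (simp only: mconst_add distrib_right) (simp add: mconst_0 mconst_1)
  qed simp
  also have "\<dots> = ribbon_sum1 (n - 2) 0 + rib (?h ones)"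
    using ones by (simp add: sum.distrib finite_compositions12 ribbon_sum1_def)
  also have "ribbon_sum1 (n - 2) 0 = chromatic_sym (cycle_verts n) (cycle_edges n)"
    using assms ribbon_sum1_eq_cycle_sum[of "n - 2"]
    by (simp add: chromatic_sym_cycle numeral_2_eq_2 Suc_diff_Suc)
  also have "rib (?h ones) = comm_image (ribbon (replicate n 1))"
    unfolding \<open>?h ones = replicate n 1\<close> rib_def ..
  finally show ?thesis
    by (simp add: nc_analog_def comm_image_diff)
qed

end
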